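(* There exist universal positive constants $c_1,\dots,c_5$ such that the following holds. Let $M^*=F^*(F^* )^\top\in\mathbb R^{d\times d}$ be positive semidefinite of rank $r$ with all $r$ nonzero eigenvalues equal and incoherence parameter $\mu$; let $S^*\in\mathbb R^{d\times d}$ be symmetric with at most $k$ nonzero entries in each row and column; let $E\in\mathbb R^{d\times d}$ be a symmetric noise matrix; and let $Y=M^*+S^*+E$. Suppose $$\frac{\mu rk}{d}\le c_1\qquad\text{and}\qquad\|E\|_F\le c_2\|F^*\|_{op} .$$ Then, given any initial matrix $F^0\in\mathbb R^{d\times r}$ satisfying $d(F^0,F^* )\le\frac15$, the projected gradient iterates $$F^{t+1}=\Pi_{\mathcal F}\big(F^t-\eta^t\nabla\tilde{\mathcal L}_n(F^t)\big)$$ with step size $\eta^t=c_3\dfrac1{\|F^*\|_{op}^2}$ satisfy, for all $t=1,2,\dots$, $$d^2(F^t,F^* )\le(1-c_4)^t\,d^2(F^0,F^* )+c_5\frac{\|E\|_F^2}{\|F^*\|_{op}^2}.$$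
   Context: The loss is $\mathcal L_n(M)=\frac12\min_{S\in\mathcal S}\|M+S-Y\|_F^2$, with $\mathcal S=\{S\in\mathbb R^{d\times d}:\|S_{i\cdot}\|_1\le\|S^*_{i\cdot}\|_1,\ i=1,\dots,d\}$ (the $\ell_1$ norms of the rows of $S^*$ are assumed known). Its gradient is $\nabla\mathcal L_n(M)=M+\Pi_{\mathcal S}(Y-M)-Y$. The factorized loss is $\tilde{\mathcal L}_n(F)=\mathcal L_n(FF^\top)$, with gradient $\nabla\tilde{\mathcal L}_n(F)=2\big\{\Pi_{\mathcal S}(Y-FF^\top)-(Y-FF^\top)\big\}F$. The constraint set is $\mathcal F=\{F\in\mathbb R^{d\times r}:\|F\|_{2,\infty}\le\sqrt{2\mu/d}\,\|F^0\|_F\}$. $\Pi_{\mathcal S}$, $\Pi_{\mathcal F}$ are Euclidean (Frobenius) projections. $\|\cdot\|_F$ is the Frobenius norm, $\|\cdot\|_{op}$ the spectral norm, $\|Z\|_{2,\infty}=\max_i\|Z_{i\cdot}\|_2$. $F^*\in\mathbb R^{d\times r}$ has orthogonal columns with $F^*(F^* )^\top=M^*$. Incoherence parameter: $\mu=\frac{d\|F^*\|_{2,\infty}^2}{r\|F^*\|_{op}^2}$. $\mathcal E(M^* )=\{A\in\mathbb R^{d\times r}:AA^\top=M^*,\ A_{\cdot i}^\top A_{\cdot j}=0\ \forall i\ne j\}$ and $d(F,F^* )=\min_{A\in\mathcal E(M^* )}\|F-A\|_F$.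
   Formalization: The initial condition is d(F^0,F^* ) ≤ ‖F^*‖_op/5 instead of 1/5, and the noise condition is ‖E‖_F ≤ c_2‖F^*‖_op^2 instead of c_2‖F^*‖_op; as printed the claim fails for small ‖F^*‖_op (e.g. d=r=1, F^*=1/5, S^*=E=0, F^0=0). *)

theory Defs
  imports Complex_Main "Jordan_Normal_Form.DL_Rank" "Jordan_Normal_Form.Char_Poly"
begin

text \<open>Matrices with explicit dimensions are used, rather than type-indexed ones, because the
  constants in the theorem are universal: they are chosen before the dimensions.\<close>

definition l1_norm :: "real vec \<Rightarrow> real" where
  "l1_norm v = (\<Sum>i<dim_vec v. \<bar>v $ i\<bar>)"

definition l2_norm :: "real vec \<Rightarrow> real" where
  "l2_norm v = sqrt (\<Sum>i<dim_vec v. (v $ i)\<^sup>2)"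

definition frob_norm :: "real mat \<Rightarrow> real" where
  "frob_norm A = sqrt (\<Sum>i<dim_row A. \<Sum>j<dim_col A. (A $$ (i, j))\<^sup>2)"

definition spectral_norm :: "real mat \<Rightarrow> real" where
  "spectral_norm A = (SUP x \<in> {x \<in> carrier_vec (dim_col A). l2_norm x \<le> 1}. l2_norm (A *\<^sub>v x))"

text \<open>Only meaningful when there is at least one row.\<close>
definition two_inf_norm :: "real mat \<Rightarrow> real" where
  "two_inf_norm A = Max ((\<lambda>i. l2_norm (row A i)) ` {..<dim_row A})"

text \<open>The minimizer is unique for a nonempty closed convex \<open>C\<close> of matrices of the same
  dimensions as \<open>X\<close>, which is the case for both constraint sets below.\<close>
definition frob_proj :: "real mat set \<Rightarrow> real mat \<Rightarrow> real mat" where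
  "frob_proj C X = arg_min_on (\<lambda>P. frob_norm (X - P)) C"

definition incoherence :: "real mat \<Rightarrow> real" where
  "incoherence F =
     real (dim_row F) * (two_inf_norm F)\<^sup>2 / (real (dim_col F) * (spectral_norm F)\<^sup>2)"

definition orth_factors :: "nat \<Rightarrow> real mat \<Rightarrow> real mat set" where
  "orth_factors r M = {A \<in> carrier_mat (dim_row M) r.
     A * A\<^sup>T = M \<and> (\<forall>i<r. \<forall>j<r. i \<noteq> j \<longrightarrow> col A i \<bullet> col A j = 0)}"

text \<open>Distance of \<open>F\<close> to the set of factors of \<open>Fs * Fs\<^sup>T\<close>; that set is compact, and it contains
  \<open>Fs\<close> as soon as \<open>Fs\<close> has orthogonal columns, so the infimum is a minimum.\<close>
definition factor_dist :: "real mat \<Rightarrow> real mat \<Rightarrow> real" where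
  "factor_dist F Fs = (INF A \<in> orth_factors (dim_col Fs) (Fs * Fs\<^sup>T). frob_norm (F - A))"

definition row_l1_set :: "real mat \<Rightarrow> real mat set" where
  "row_l1_set Ss = {S \<in> carrier_mat (dim_row Ss) (dim_col Ss).
     \<forall>i<dim_row Ss. l1_norm (row S i) \<le> l1_norm (row Ss i)}"

definition incoherent_set :: "real \<Rightarrow> real mat \<Rightarrow> real mat set" where
  "incoherent_set \<mu> F0 = {F \<in> carrier_mat (dim_row F0) (dim_col F0).
     two_inf_norm F \<le> sqrt (2 * \<mu> / real (dim_row F0)) * frob_norm F0}"

text \<open>The loss is \<open>M \<mapsto> 1/2 * min_S \<parallel>M + S - Y\<parallel>\<^sup>2\<close> (Frobenius norm, \<open>S\<close> ranging over
  \<open>row_l1_set Ss\<close>). Its gradient is \<open>G = M + \<Pi>(Y - M) - Y\<close>, and the search direction of the method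
  at a factor \<open>F\<close> is \<open>2 G F\<close> with \<open>M = F F\<^sup>T\<close>. The row-wise projection need not preserve
  symmetry, so this is the direction by convention; no symmetrization of \<open>G\<close> takes place.\<close>
definition factored_grad :: "real mat \<Rightarrow> real mat \<Rightarrow> real mat \<Rightarrow> real mat" where
  "factored_grad Y Ss F =
     2 \<cdot>\<^sub>m ((frob_proj (row_l1_set Ss) (Y - F * F\<^sup>T) - (Y - F * F\<^sup>T)) * F)"

primrec pgd :: "real mat \<Rightarrow> real mat \<Rightarrow> real \<Rightarrow> real \<Rightarrow> real mat \<Rightarrow> nat \<Rightarrow> real mat" where
  "pgd Y Ss \<mu> \<eta> F0 0 = F0"
| "pgd Y Ss \<mu> \<eta> F0 (Suc t) =
     frob_proj (incoherent_set \<mu> F0)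
       (pgd Y Ss \<mu> \<eta> F0 t - \<eta> \<cdot>\<^sub>m factored_grad Y Ss (pgd Y Ss \<mu> \<eta> F0 t))"

definition equal_nonzero_eigenvalues :: "real mat \<Rightarrow> bool" where
  "equal_nonzero_eigenvalues M \<longleftrightarrow>
     (\<forall>a b. eigenvalue M a \<and> eigenvalue M b \<and> a \<noteq> 0 \<and> b \<noteq> 0 \<longrightarrow> a = b)"

definition row_col_sparse :: "nat \<Rightarrow> real mat \<Rightarrow> bool" where
  "row_col_sparse k S \<longleftrightarrow>
     (\<forall>i<dim_row S. card {j. j < dim_col S \<and> S $$ (i, j) \<noteq> 0} \<le> k) \<and>
     (\<forall>j<dim_col S. card {i. i < dim_row S \<and> S $$ (i, j) \<noteq> 0} \<le> k)"

text \<open>Scaling convention for the theorem. Replacing \<open>Fs, F0\<close> by \<open>s Fs, s F0\<close> and \<open>Ss, E\<close> by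
  \<open>s\<^sup>2 Ss, s\<^sup>2 E\<close> rescales every iterate by \<open>s\<close>. The radius \<open>1/5\<close> for \<open>F0\<close> and the noise level
  for \<open>E\<close> are accordingly taken relative to the spectral norm of \<open>Fs\<close> and to its square. In
  absolute units the local convergence claim fails for small \<open>Fs\<close>: for \<open>d = r = 1\<close>, \<open>Fs = 1/5\<close>,
  \<open>Ss = E = 0\<close> the initial matrix \<open>F0 = 0\<close> is within distance \<open>1/5\<close> of \<open>Fs\<close>, and the method
  never leaves it.\<close>

end

theory Submission
  imports Defs "HOL-Analysis.L2_Norm"
begin

text \<open>Write \<open>s = spectral_norm Fs\<close>. Since the nonzero eigenvalues of \<open>Ms\<close> agree, every orthogonal factor
  \<open>A\<close> of \<open>Ms\<close> satisfies \<open>A\<^sup>T A = s\<^sup>2 I\<close>. For an iterate \<open>F\<close>, let \<open>A\<close> be its closest factor,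
  \<open>\<Delta> = F - A\<close> and \<open>G\<close> the gradient of the loss at \<open>F F\<^sup>T\<close>. Optimality of \<open>A\<close> makes
  \<open>A\<^sup>T \<Delta>\<close> symmetric, whence \<open>\<langle>F F\<^sup>T - Ms, \<Delta> F\<^sup>T\<rangle> \<ge> 0.91 s\<^sup>2 \<parallel>\<Delta>\<parallel>\<^sup>2\<close> as long as \<open>\<parallel>\<Delta>\<parallel> \<le> s / 5\<close>.
  The matrix \<open>G\<close> differs from \<open>F F\<^sup>T - Ms - E\<close> by the error \<open>S' - Ss\<close> of the projection, whose rows
  have \<open>l1\<close> norm at most \<open>2 sqrt k\<close> times their \<open>l2\<close> norm; paired with \<open>\<Delta> F\<^sup>T = \<Delta> A\<^sup>T + \<Delta> \<Delta>\<^sup>T\<close> it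
  contributes at most a fraction of the curvature. So \<open>\<langle>G F, \<Delta>\<rangle>\<close> dominates \<open>s\<^sup>2 \<parallel>\<Delta>\<parallel>\<^sup>2\<close> up to
  noise and one step contracts \<open>\<parallel>\<Delta>\<parallel>\<^sup>2\<close>; the projection onto the incoherent set, which contains
  \<open>A\<close>, does not increase the distance to \<open>A\<close>.\<close>

declare minus_carrier_mat [simp]

section \<open>The Frobenius inner product\<close>

definition mat_inner :: "real mat \<Rightarrow> real mat \<Rightarrow> real" where
  "mat_inner A B = (\<Sum>i<dim_row A. \<Sum>j<dim_col A. A $$ (i, j) * B $$ (i, j))"

lemma mat_inner_carrier:
  assumes "A \<in> carrier_mat n m"
  shows "mat_inner A B = (\<Sum>i<n. \<Sum>j<m. A $$ (i, j) * B $$ (i, j))"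
  using assms by (auto simp: mat_inner_def)

lemma mat_inner_commute:
  assumes "A \<in> carrier_mat n m" "B \<in> carrier_mat n m"
  shows "mat_inner A B = mat_inner B A"
  using assms by (simp add: mat_inner_carrier mult.commute)

lemma mat_inner_add_left:
  assumes "A \<in> carrier_mat n m" "B \<in> carrier_mat n m"
  shows "mat_inner (A + B) C = mat_inner A C + mat_inner B C"
  using assms by (simp add: mat_inner_def algebra_simps sum.distrib)

lemma mat_inner_minus_left:
  assumes "A \<in> carrier_mat n m" "B \<in> carrier_mat n m"
  shows "mat_inner (A - B) C = mat_inner A C - mat_inner B C"
  using assms by (simp add: mat_inner_def algebra_simps sum_subtractf)

lemma mat_inner_add_right:
  assumes "A \<in> carrier_mat n m" "B \<in> carrier_mat n m" "C \<in> carrier_mat n m"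
  shows "mat_inner C (A + B) = mat_inner C A + mat_inner C B"
  using assms by (simp add: mat_inner_def algebra_simps sum.distrib)

lemma mat_inner_minus_right:
  assumes "A \<in> carrier_mat n m" "B \<in> carrier_mat n m" "C \<in> carrier_mat n m"
  shows "mat_inner C (A - B) = mat_inner C A - mat_inner C B"
  using assms by (simp add: mat_inner_def algebra_simps sum_subtractf)

lemma mat_inner_smult_right:
  assumes "A \<in> carrier_mat n m" "C \<in> carrier_mat n m"
  shows "mat_inner C (c \<cdot>\<^sub>m A) = c * mat_inner C A"
  using assms by (simp add: mat_inner_def algebra_simps sum_distrib_left)

lemma mat_inner_transpose:
  assumes "A \<in> carrier_mat n m" "B \<in> carrier_mat n m"
  shows "mat_inner A\<^sup>T B\<^sup>T = mat_inner A B"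
proof -
  have "mat_inner A\<^sup>T B\<^sup>T = (\<Sum>j<m. \<Sum>i<n. A $$ (i, j) * B $$ (i, j))"
    using assms by (auto simp: mat_inner_def intro!: sum.cong)
  then show ?thesis
    using assms sum.swap[of "\<lambda>i j. A $$ (i, j) * B $$ (i, j)" "{..<m}" "{..<n}"]
    by (simp add: mat_inner_carrier)
qed

lemma index_mult_mat_sum:
  assumes "A \<in> carrier_mat n m" "B \<in> carrier_mat m p" "i < n" "j < p"
  shows "(A * B) $$ (i, j) = (\<Sum>l<m. A $$ (i, l) * B $$ (l, j))"
  using assms by (auto simp: scalar_prod_def lessThan_atLeast0 intro!: sum.cong)

text \<open>Multiplication by \<open>B\<close> on the right has multiplication by
  \<open>B\<^sup>T\<close> as its adjoint. Later this turns the pairing of \<open>G * F\<close> with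
  \<open>D\<close> into that of \<open>G\<close> with \<open>D * F\<^sup>T\<close>, where row
  sparsity can be used.\<close>

lemma mat_inner_mult_right_adjoint:
  assumes "A \<in> carrier_mat n m" "B \<in> carrier_mat m p" "C \<in> carrier_mat n p"
  shows "mat_inner (A * B) C = mat_inner A (C * B\<^sup>T)"
proof -
  have "mat_inner (A * B) C = (\<Sum>i<n. \<Sum>j<p. \<Sum>l<m. A $$ (i, l) * B $$ (l, j) * C $$ (i, j))"
    using assms
    by (simp add: mat_inner_carrier[of _ n p] index_mult_mat_sum[OF assms(1,2)] sum_distrib_right
        del: index_mult_mat)
  also have "\<dots> = (\<Sum>i<n. \<Sum>l<m. \<Sum>j<p. A $$ (i, l) * B $$ (l, j) * C $$ (i, j))"
    by (intro sum.cong refl sum.swap)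
  also have "\<dots> = mat_inner A (C * B\<^sup>T)"
    using assms
    by (simp add: mat_inner_carrier[of _ n m] index_mult_mat_sum[of C n p "B\<^sup>T" m]
        sum_distrib_left mult_ac del: index_mult_mat)
  finally show ?thesis .
qed

text \<open>Transposing both arguments reduces this to the adjoint of right multiplication.\<close>

lemma mat_inner_mult_left_adjoint:
  assumes "A \<in> carrier_mat n m" "B \<in> carrier_mat m p" "C \<in> carrier_mat n p"
  shows "mat_inner (A * B) C = mat_inner B (A\<^sup>T * C)"
proof -
  have "mat_inner (A * B) C = mat_inner (B\<^sup>T * A\<^sup>T) C\<^sup>T"
    using assms mat_inner_transpose[of "A * B" n p C] by (simp add: transpose_mult[of A n m B p])
  also have "\<dots> = mat_inner B\<^sup>T (C\<^sup>T * A)"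
    using assms by (subst mat_inner_mult_right_adjoint[of _ p m _ n]) auto
  also have "C\<^sup>T * A = (A\<^sup>T * C)\<^sup>T"
    using assms by (simp add: transpose_mult[of "A\<^sup>T" m n C p])
  also have "mat_inner B\<^sup>T (A\<^sup>T * C)\<^sup>T = mat_inner B (A\<^sup>T * C)"
    using assms by (intro mat_inner_transpose) auto
  finally show ?thesis .
qed

section \<open>Norm identities and inequalities\<close>

lemma frob_norm_nonneg [simp]: "0 \<le> frob_norm A"
  by (simp add: frob_norm_def sum_nonneg)

lemma mat_inner_self: "mat_inner A A = (frob_norm A)\<^sup>2"
  by (simp add: frob_norm_def mat_inner_def sum_nonneg power2_eq_square)

lemma frob_norm_L2_set:
  assumes "A \<in> carrier_mat n m"
  shows "frob_norm A = L2_set (\<lambda>p. A $$ p) ({..<n} \<times> {..<m})"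
  using assms by (auto simp: frob_norm_def L2_set_def sum.cartesian_product)

lemma mat_inner_cauchy_schwarz:
  assumes "A \<in> carrier_mat n m" "B \<in> carrier_mat n m"
  shows "\<bar>mat_inner A B\<bar> \<le> frob_norm A * frob_norm B"
proof -
  have "mat_inner A B = (\<Sum>p\<in>{..<n} \<times> {..<m}. A $$ p * B $$ p)"
    using assms by (auto simp: mat_inner_carrier sum.cartesian_product split_def)
  also have "\<bar>\<dots>\<bar> \<le> (\<Sum>p\<in>{..<n} \<times> {..<m}. \<bar>A $$ p\<bar> * \<bar>B $$ p\<bar>)"
    by (rule order.trans[OF sum_abs]) (simp add: abs_mult)
  also have "\<dots> \<le> frob_norm A * frob_norm B"
    using assms by (simp add: frob_norm_L2_set L2_set_mult_ineq)
  finally show ?thesis .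
qed

lemma frob_norm_add_sq:
  assumes "A \<in> carrier_mat n m" "B \<in> carrier_mat n m"
  shows "(frob_norm (A + B))\<^sup>2 = (frob_norm A)\<^sup>2 + 2 * mat_inner A B + (frob_norm B)\<^sup>2"
  using assms mat_inner_commute[OF assms]
  by (simp flip: mat_inner_self add: mat_inner_add_left[of _ n m] mat_inner_add_right[of _ n m])

lemma frob_norm_minus_sq:
  assumes "A \<in> carrier_mat n m" "B \<in> carrier_mat n m"
  shows "(frob_norm (A - B))\<^sup>2 = (frob_norm A)\<^sup>2 - 2 * mat_inner A B + (frob_norm B)\<^sup>2"
  using assms mat_inner_commute[OF assms]
  by (simp flip: mat_inner_self add: mat_inner_minus_left[of _ n m] mat_inner_minus_right[of _ n m])

lemma frob_norm_smult: "frob_norm (c \<cdot>\<^sub>m A) = \<bar>c\<bar> * frob_norm A"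
  by (simp add: frob_norm_def power_mult_distrib real_sqrt_mult flip: sum_distrib_left)

lemma frob_norm_transpose [simp]: "frob_norm A\<^sup>T = frob_norm A"
proof -
  have "(frob_norm A\<^sup>T)\<^sup>2 = (frob_norm A)\<^sup>2"
    unfolding mat_inner_self[symmetric] by (rule mat_inner_transpose) auto
  then show ?thesis by (simp add: power2_eq_iff_nonneg)
qed

lemma frob_norm_triangle:
  assumes "A \<in> carrier_mat n m" "B \<in> carrier_mat n m"
  shows "frob_norm (A + B) \<le> frob_norm A + frob_norm B"
proof (rule power2_le_imp_le)
  show "(frob_norm (A + B))\<^sup>2 \<le> (frob_norm A + frob_norm B)\<^sup>2"
    using mat_inner_cauchy_schwarz[OF assms]
    by (simp add: frob_norm_add_sq[OF assms] power2_sum)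
qed simp

lemma frob_norm_triangle_minus:
  assumes "A \<in> carrier_mat n m" "B \<in> carrier_mat n m"
  shows "frob_norm (A - B) \<le> frob_norm A + frob_norm B"
proof (rule power2_le_imp_le)
  show "(frob_norm (A - B))\<^sup>2 \<le> (frob_norm A + frob_norm B)\<^sup>2"
    using mat_inner_cauchy_schwarz[OF assms]
    by (simp add: frob_norm_minus_sq[OF assms] power2_sum)
qed simp

lemma sum_mult_sq_le:
  fixes f g :: "'i \<Rightarrow> real"
  shows "(\<Sum>i\<in>I. f i * g i)\<^sup>2 \<le> (\<Sum>i\<in>I. (f i)\<^sup>2) * (\<Sum>i\<in>I. (g i)\<^sup>2)"
proof -
  have "\<bar>\<Sum>i\<in>I. f i * g i\<bar> \<le> L2_set f I * L2_set g I"
    by (rule order.trans[OF sum_abs order.trans[OF _ L2_set_mult_ineq]]) (simp add: abs_mult)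
  then have "(\<Sum>i\<in>I. f i * g i)\<^sup>2 \<le> (L2_set f I * L2_set g I)\<^sup>2"
    by (rule abs_le_square_iff[THEN iffD1, OF order.trans]) simp
  then show ?thesis
    by (simp add: L2_set_def power_mult_distrib sum_nonneg)
qed

text \<open>Cauchy-Schwarz bounds each squared entry of the product by a squared row length times a
  squared column length, and the double sum of these bounds factors.\<close>

lemma frob_norm_mult_le:
  assumes "A \<in> carrier_mat n m" "B \<in> carrier_mat m p"
  shows "frob_norm (A * B) \<le> frob_norm A * frob_norm B"
proof -
  have "(frob_norm (A * B))\<^sup>2 = (\<Sum>i<n. \<Sum>j<p. (\<Sum>l<m. A $$ (i, l) * B $$ (l, j))\<^sup>2)"
    unfolding mat_inner_self[symmetric] using assms
    by (simp add: mat_inner_carrier[of _ n p] index_mult_mat_sum[OF assms] power2_eq_square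
        del: index_mult_mat)
  also have "\<dots> \<le> (\<Sum>i<n. \<Sum>j<p. (\<Sum>l<m. (A $$ (i, l))\<^sup>2) * (\<Sum>l<m. (B $$ (l, j))\<^sup>2))"
    by (intro sum_mono sum_mult_sq_le)
  also have "\<dots> = (\<Sum>i<n. \<Sum>l<m. (A $$ (i, l))\<^sup>2) * (\<Sum>j<p. \<Sum>l<m. (B $$ (l, j))\<^sup>2)"
    by (simp add: sum_product)
  also have "\<dots> = (\<Sum>i<n. \<Sum>l<m. (A $$ (i, l))\<^sup>2) * (\<Sum>l<m. \<Sum>j<p. (B $$ (l, j))\<^sup>2)"
    by (subst (2) sum.swap) simp
  also have "\<dots> = (frob_norm A * frob_norm B)\<^sup>2"
    using assms
    by (simp add: power_mult_distrib flip: mat_inner_self)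
       (simp add: mat_inner_carrier[of _ n m] mat_inner_carrier[of _ m p] power2_eq_square)
  finally show ?thesis
    by (rule power2_le_imp_le) simp
qed

text \<open>Moving \<open>A\<^sup>T\<close> to the other side of the inner product produces
  \<open>A\<^sup>T * A\<close>, a multiple of the identity.\<close>

lemma frob_norm_mult_transpose_semi_orth:
  assumes "A \<in> carrier_mat d r" "A\<^sup>T * A = c \<cdot>\<^sub>m 1\<^sub>m r" "X \<in> carrier_mat n r"
  shows "(frob_norm (X * A\<^sup>T))\<^sup>2 = c * (frob_norm X)\<^sup>2"
proof -
  have "(frob_norm (X * A\<^sup>T))\<^sup>2 = mat_inner X (X * A\<^sup>T * A)"
    using assms by (simp flip: mat_inner_self add: mat_inner_mult_right_adjoint[of X n r _ d])
  also have "X * A\<^sup>T * A = c \<cdot>\<^sub>m X"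
    using assms by (simp add: assoc_mult_mat[of X n r "A\<^sup>T" d A r] mult_smult_distrib[of X n r _ r])
  finally show ?thesis
    using assms by (simp add: mat_inner_smult_right[of _ n r] mat_inner_self)
qed

text \<open>The square of the left side is the pairing of \<open>X * A * A\<^sup>T\<close> with
  \<open>X\<close>. By Cauchy-Schwarz and the preceding identity it is at most
  \<open>s * frob_norm (X * A) * frob_norm X\<close>, and one factor cancels.\<close>

lemma frob_norm_mult_semi_orth_le:
  assumes "A \<in> carrier_mat d r" "A\<^sup>T * A = s\<^sup>2 \<cdot>\<^sub>m 1\<^sub>m r" "0 \<le> s" "X \<in> carrier_mat n d"
  shows "frob_norm (X * A) \<le> s * frob_norm X"
proof -
  have "(frob_norm (X * A))\<^sup>2 = mat_inner (X * A * A\<^sup>T) X"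
    using assms
    by (simp flip: mat_inner_self add: mat_inner_mult_right_adjoint[of X n d A r]
        mat_inner_commute[of _ n d X])
  also have "\<dots> \<le> frob_norm (X * A * A\<^sup>T) * frob_norm X"
    using mat_inner_cauchy_schwarz[of "X * A * A\<^sup>T" n d X] assms by simp
  also have "frob_norm (X * A * A\<^sup>T) = s * frob_norm (X * A)"
    using frob_norm_mult_transpose_semi_orth[OF assms(1,2), of "X * A" n] assms
    by (simp add: power_mult_distrib[symmetric])
  finally have "frob_norm (X * A) * frob_norm (X * A) \<le> frob_norm (X * A) * (s * frob_norm X)"
    by (simp add: power2_eq_square mult_ac)
  then show ?thesis
    using assms(3) by (cases "frob_norm (X * A) = 0") (auto simp: less_le)
qed

section \<open>Frobenius projections\<close>

text \<open>Sequential closedness, with convergence taken entry by entry. The two constraint sets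
  and the set of orthogonal factors are all cut out by conditions continuous in the entries.\<close>

definition entrywise_closed :: "nat \<Rightarrow> nat \<Rightarrow> real mat set \<Rightarrow> bool" where
  "entrywise_closed n m C \<longleftrightarrow> C \<subseteq> carrier_mat n m \<and>
     (\<forall>X A. (\<forall>k. X k \<in> C) \<and> A \<in> carrier_mat n m \<and>
        (\<forall>i<n. \<forall>j<m. (\<lambda>k. X k $$ (i, j)) \<longlonglongrightarrow> A $$ (i, j)) \<longrightarrow> A \<in> C)"

text \<open>Bolzano-Weierstrass for finitely many coordinates: each new coordinate is made monotone
  along a further subsequence, which keeps the convergence of the earlier ones.\<close>

lemma bounded_family_convergent_subseq:
  fixes x :: "nat \<Rightarrow> 'i \<Rightarrow> real"
  assumes "finite I" "\<And>i. i \<in> I \<Longrightarrow> Bseq (\<lambda>n. x n i)"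
  shows "\<exists>f :: nat \<Rightarrow> nat. strict_mono f \<and> (\<forall>i\<in>I. convergent (\<lambda>n. x (f n) i))"
  using assms
proof (induction I rule: finite_induct)
  case empty
  then show ?case by (auto intro: exI[of _ id] simp: strict_mono_id[unfolded id_def] id_def)
next
  case (insert a I)
  then obtain f :: "nat \<Rightarrow> nat" where f: "strict_mono f" "\<forall>i\<in>I. convergent (\<lambda>n. x (f n) i)"
    by auto
  obtain g :: "nat \<Rightarrow> nat" where g: "strict_mono g" "monoseq (\<lambda>n. x (f (g n)) a)"
    using seq_monosub[of "\<lambda>n. x (f n) a"] by auto
  have "Bseq (\<lambda>n. x (f (g n)) a)"
    using insert.prems[of a] by (auto simp: Bseq_def)
  then have "convergent (\<lambda>n. x (f (g n)) a)"
    using g(2) by (rule Bseq_monoseq_convergent)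
  moreover have "convergent (\<lambda>n. x (f (g n)) i)" if "i \<in> I" for i
    using convergent_subseq_convergent[of "\<lambda>n. x (f n) i" g] f(2) g(1) that by (auto simp: o_def)
  ultimately show ?case
    using strict_mono_o[OF f(1) g(1)] by (intro exI[of _ "f \<circ> g"]) (auto simp: o_def)
qed

lemma abs_index_le_frob_norm:
  assumes "A \<in> carrier_mat n m" "i < n" "j < m"
  shows "\<bar>A $$ (i, j)\<bar> \<le> frob_norm A"
proof -
  have "\<bar>A $$ (i, j)\<bar> \<le> L2_set (\<lambda>p. \<bar>A $$ p\<bar>) ({..<n} \<times> {..<m})"
    using assms by (intro member_le_L2_set) auto
  also have "\<dots> = frob_norm A"
    using assms by (simp add: frob_norm_L2_set L2_set_def)
  finally show ?thesis .
qed

text \<open>A minimizing sequence has bounded entries, so a subsequence converges entrywise. The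
  limit lies in \<open>C\<close> by closedness and attains the infimum by continuity of the
  norm.\<close>

lemma ex_closest_point:
  assumes C: "entrywise_closed n m C" "C \<noteq> {}" and X: "X \<in> carrier_mat n m"
  shows "\<exists>P\<in>C. \<forall>Q\<in>C. frob_norm (X - P) \<le> frob_norm (X - Q)"
proof -
  define I where "I = (INF Q\<in>C. frob_norm (X - Q))"
  have bdd: "bdd_below ((\<lambda>Q. frob_norm (X - Q)) ` C)"
    by (rule bdd_belowI2[of _ 0]) simp
  have "\<exists>Q\<in>C. frob_norm (X - Q) < I + 1 / Suc k" for k
    unfolding I_def using C(2) bdd
    by (subst cINF_less_iff[symmetric]) auto
  then obtain Z where Z: "Z k \<in> C" "frob_norm (X - Z k) < I + 1 / Suc k" for k
    by metis
  have ZC: "Z k \<in> carrier_mat n m" for k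
    using Z(1) C(1) by (auto simp: entrywise_closed_def)
  have "Bseq (\<lambda>k. Z k $$ p)" if p: "p \<in> {..<n} \<times> {..<m}" for p
  proof -
    obtain i j where ij: "p = (i, j)" "i < n" "j < m" using p by auto
    have "\<bar>Z k $$ p\<bar> \<le> \<bar>X $$ p\<bar> + I + 1" for k
    proof -
      have "\<bar>(X - Z k) $$ (i, j)\<bar> \<le> I + 1 / Suc k"
        using abs_index_le_frob_norm[of "X - Z k" n m i j] Z(2)[of k] ZC[of k] ij by fastforce
      also have "\<dots> \<le> I + 1" by simp
      finally show ?thesis
        using ij X ZC[of k] by (simp del: of_nat_Suc)
    qed
    then show ?thesis by (intro BseqI') auto
  qed
  from bounded_family_convergent_subseq[of "{..<n} \<times> {..<m}" "\<lambda>k p. Z k $$ p", OF _ this]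
  obtain f :: "nat \<Rightarrow> nat" where f: "strict_mono f"
    "\<forall>p\<in>{..<n} \<times> {..<m}. convergent (\<lambda>k. Z (f k) $$ p)" by blast
  define P where "P = mat n m (\<lambda>p. lim (\<lambda>k. Z (f k) $$ p))"
  have P: "P \<in> carrier_mat n m" by (simp add: P_def)
  have lim: "(\<lambda>k. Z (f k) $$ (i, j)) \<longlonglongrightarrow> P $$ (i, j)" if "i < n" "j < m" for i j
    using f(2) that by (simp add: P_def convergent_LIMSEQ_iff)
  have "P \<in> C"
    using C(1) Z(1) P lim unfolding entrywise_closed_def
    by (auto dest!: spec[of _ "\<lambda>k. Z (f k)"] spec[of _ P])
  moreover have "frob_norm (X - P) \<le> I"
  proof (rule LIMSEQ_le)
    have eq: "frob_norm (X - B) = sqrt (\<Sum>i<n. \<Sum>j<m. (X $$ (i, j) - B $$ (i, j))\<^sup>2)"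
      if "B \<in> carrier_mat n m" for B
      using that X by (simp add: frob_norm_def)
    show "(\<lambda>k. frob_norm (X - Z (f k))) \<longlonglongrightarrow> frob_norm (X - P)"
      unfolding eq[OF ZC] eq[OF P] using lim by (intro tendsto_intros) auto
    have "(\<lambda>k. I + 1 / Suc k) \<longlonglongrightarrow> I + 0"
      by (intro tendsto_intros LIMSEQ_Suc[OF lim_1_over_n])
    from LIMSEQ_subseq_LIMSEQ[OF this f(1)]
    show "(\<lambda>k. I + 1 / Suc (f k)) \<longlonglongrightarrow> I" by (simp add: o_def)
    show "\<exists>N. \<forall>k\<ge>N. frob_norm (X - Z (f k)) \<le> I + 1 / Suc (f k)"
      using Z(2) by (auto intro: less_imp_le)
  qed
  moreover have "I \<le> frob_norm (X - Q)" if "Q \<in> C" for Q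
    unfolding I_def using bdd that by (rule cINF_lower)
  ultimately show ?thesis by (auto intro: order.trans)
qed

definition mat_convex :: "real mat set \<Rightarrow> bool" where
  "mat_convex C \<longleftrightarrow> (\<forall>P\<in>C. \<forall>Q\<in>C. \<forall>t. 0 \<le> t \<and> t \<le> 1 \<longrightarrow> (1 - t) \<cdot>\<^sub>m P + t \<cdot>\<^sub>m Q \<in> C)"

text \<open>Divide by \<open>t\<close> and let it tend to 0. This extracts first-order optimality
  conditions: for projections along segments, and for the closest factor along rotations.\<close>

lemma nonpos_if_linear_le_quadratic:
  fixes a b :: real
  assumes "\<And>t. 0 < t \<Longrightarrow> t \<le> 1 \<Longrightarrow> t * a \<le> t\<^sup>2 * b"
  shows "a \<le> 0"
proof (rule ccontr)
  assume "\<not> a \<le> 0"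
  then have a: "a > 0" by simp
  \<comment> \<open>Small enough that \<open>t * b\<close> is at most half of \<open>a\<close>; the
    summand 1 keeps the denominator positive when \<open>b = 0\<close>.\<close>
  define t where "t = min 1 (a / (2 * (\<bar>b\<bar> + 1)))"
  have t: "0 < t" "t \<le> 1" "t * (\<bar>b\<bar> + 1) \<le> a / 2"
  proof -
    show "0 < t" "t \<le> 1" using a by (auto simp: t_def)
    have "t \<le> a / (2 * (\<bar>b\<bar> + 1))" by (simp add: t_def)
    then show "t * (\<bar>b\<bar> + 1) \<le> a / 2" by (simp add: field_simps)
  qed
  have "a \<le> t * b"
    using assms[OF t(1,2)] t(1) by (simp add: power2_eq_square)
  also have "\<dots> \<le> t * (\<bar>b\<bar> + 1)" using t(1) by (intro mult_left_mono) auto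
  finally show False using t(3) a by simp
qed

text \<open>A closest point exists, so the choice made by \<open>arg_min_on\<close> really is one.
  Comparing it with the points of the segment to \<open>Q\<close> shows that \<open>X - P\<close>
  and \<open>Q - P\<close> do not form an acute angle; expanding the square of
  \<open>X - Q = (X - P) - (Q - P)\<close> then shows that projecting does not increase the distance
  to any point of \<open>C\<close>.\<close>

lemma frob_proj:
  assumes C: "entrywise_closed n m C" "mat_convex C" and X: "X \<in> carrier_mat n m" and Q: "Q \<in> C"
  shows frob_proj_mem: "frob_proj C X \<in> C"
    and frob_proj_le: "frob_norm (X - frob_proj C X) \<le> frob_norm (X - Q)"
    and frob_norm_proj_diff_le: "frob_norm (frob_proj C X - Q) \<le> frob_norm (X - Q)"
proof -
  define P where "P = frob_proj C X"
  have "is_arg_min (\<lambda>P. frob_norm (X - P)) (\<lambda>P. P \<in> C) P"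
  proof -
    obtain R where "is_arg_min (\<lambda>P. frob_norm (X - P)) (\<lambda>P. P \<in> C) R"
      using ex_closest_point[OF C(1) _ X] Q by (auto simp: is_arg_min_linorder)
    then show ?thesis
      unfolding P_def frob_proj_def arg_min_on_def arg_min_def by (rule someI)
  qed
  then have P: "P \<in> C" and le: "\<And>Q. Q \<in> C \<Longrightarrow> frob_norm (X - P) \<le> frob_norm (X - Q)"
    by (auto simp: is_arg_min_linorder)
  have car: "P \<in> carrier_mat n m" "Q \<in> carrier_mat n m"
    using P Q C(1) by (auto simp: entrywise_closed_def)
  have "2 * mat_inner (X - P) (Q - P) \<le> 0"
  proof (rule nonpos_if_linear_le_quadratic)
    fix t :: real assume t: "0 < t" "t \<le> 1"
    have "(1 - t) \<cdot>\<^sub>m P + t \<cdot>\<^sub>m Q \<in> C"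
      using C(2) P Q t by (auto simp: mat_convex_def)
    from le[OF this] have "(frob_norm (X - P))\<^sup>2 \<le> (frob_norm (X - ((1 - t) \<cdot>\<^sub>m P + t \<cdot>\<^sub>m Q)))\<^sup>2"
      by (intro power_mono) auto
    also have "X - ((1 - t) \<cdot>\<^sub>m P + t \<cdot>\<^sub>m Q) = (X - P) - t \<cdot>\<^sub>m (Q - P)"
      using car X by (intro eq_matI) (auto simp: algebra_simps)
    also have "(frob_norm \<dots>)\<^sup>2
        = (frob_norm (X - P))\<^sup>2 - 2 * t * mat_inner (X - P) (Q - P) + t\<^sup>2 * (frob_norm (Q - P))\<^sup>2"
      using car X
      by (subst frob_norm_minus_sq[of _ n m])
         (simp_all add: mat_inner_smult_right[of _ n m] frob_norm_smult power_mult_distrib)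
    finally show "t * (2 * mat_inner (X - P) (Q - P)) \<le> t\<^sup>2 * (frob_norm (Q - P))\<^sup>2"
      by simp
  qed
  moreover have "X - Q = (X - P) - (Q - P)"
    using car X by (intro eq_matI) auto
  then have "(frob_norm (X - Q))\<^sup>2
      = (frob_norm (X - P))\<^sup>2 - 2 * mat_inner (X - P) (Q - P) + (frob_norm (Q - P))\<^sup>2"
    using car X frob_norm_minus_sq[of "X - P" n m "Q - P"] by simp
  ultimately have "(frob_norm (Q - P))\<^sup>2 \<le> (frob_norm (X - Q))\<^sup>2"
    using zero_le_power2[of "frob_norm (X - P)"] by linarith
  then have "frob_norm (Q - P) \<le> frob_norm (X - Q)"
    by (rule power2_le_imp_le) simp
  moreover have "P - Q = (-1) \<cdot>\<^sub>m (Q - P)"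
    using car by (intro eq_matI) auto
  ultimately show "frob_norm (frob_proj C X - Q) \<le> frob_norm (X - Q)"
    by (simp add: frob_norm_smult P_def)
  show "frob_proj C X \<in> C" "frob_norm (X - frob_proj C X) \<le> frob_norm (X - Q)"
    using P le[OF Q] by (simp_all add: P_def)
qed

section \<open>The two constraint sets\<close>

lemma l2_norm_row:
  assumes "A \<in> carrier_mat n m" "i < n"
  shows "l2_norm (row A i) = L2_set (\<lambda>j. A $$ (i, j)) {..<m}"
  using assms by (auto simp: l2_norm_def L2_set_def)

lemma l1_norm_row:
  assumes "A \<in> carrier_mat n m" "i < n"
  shows "l1_norm (row A i) = (\<Sum>j<m. \<bar>A $$ (i, j)\<bar>)"
  using assms by (auto simp: l1_norm_def)

lemma frob_norm_rows:
  assumes "A \<in> carrier_mat n m"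
  shows "frob_norm A = L2_set (\<lambda>i. l2_norm (row A i)) {..<n}"
proof -
  have "frob_norm A = L2_set (\<lambda>i. L2_set (\<lambda>j. A $$ (i, j)) {..<m}) {..<n}"
    using assms by (simp add: frob_norm_def L2_set_def sum_nonneg)
  also have "\<dots> = L2_set (\<lambda>i. l2_norm (row A i)) {..<n}"
    using assms by (intro L2_set_cong) (auto simp: l2_norm_row)
  finally show ?thesis .
qed

lemma mem_row_l1_set_iff:
  assumes "Ss \<in> carrier_mat n m"
  shows "S \<in> row_l1_set Ss \<longleftrightarrow> S \<in> carrier_mat n m \<and>
    (\<forall>i<n. (\<Sum>j<m. \<bar>S $$ (i, j)\<bar>) \<le> (\<Sum>j<m. \<bar>Ss $$ (i, j)\<bar>))"
  using assms l1_norm_row[OF assms] l1_norm_row[of S n m] by (auto simp: row_l1_set_def)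

lemma entrywise_closed_row_l1_set:
  assumes Ss: "Ss \<in> carrier_mat n m"
  shows "entrywise_closed n m (row_l1_set Ss)"
  unfolding entrywise_closed_def
proof (intro conjI allI impI, goal_cases)
  case 1
  then show ?case by (auto simp: mem_row_l1_set_iff[OF Ss])
next
  case (2 X A)
  have "(\<Sum>j<m. \<bar>A $$ (i, j)\<bar>) \<le> (\<Sum>j<m. \<bar>Ss $$ (i, j)\<bar>)" if i: "i < n" for i
  proof (rule LIMSEQ_le_const2)
    show "(\<lambda>k. \<Sum>j<m. \<bar>X k $$ (i, j)\<bar>) \<longlonglongrightarrow> (\<Sum>j<m. \<bar>A $$ (i, j)\<bar>)"
      using 2 i by (intro tendsto_intros) auto
    show "\<exists>N. \<forall>k\<ge>N. (\<Sum>j<m. \<bar>X k $$ (i, j)\<bar>) \<le> (\<Sum>j<m. \<bar>Ss $$ (i, j)\<bar>)"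
      using 2 i by (auto simp: mem_row_l1_set_iff[OF Ss])
  qed
  then show ?case using 2 by (auto simp: mem_row_l1_set_iff[OF Ss])
qed

lemma mat_convex_row_l1_set:
  assumes Ss: "Ss \<in> carrier_mat n m"
  shows "mat_convex (row_l1_set Ss)"
  unfolding mat_convex_def
proof (intro ballI allI impI)
  fix P Q and t :: real
  assume PQ: "P \<in> row_l1_set Ss" "Q \<in> row_l1_set Ss" and t: "0 \<le> t \<and> t \<le> 1"
  have car: "P \<in> carrier_mat n m" "Q \<in> carrier_mat n m"
    using PQ by (auto simp: mem_row_l1_set_iff[OF Ss])
  have "(\<Sum>j<m. \<bar>((1 - t) \<cdot>\<^sub>m P + t \<cdot>\<^sub>m Q) $$ (i, j)\<bar>) \<le> (\<Sum>j<m. \<bar>Ss $$ (i, j)\<bar>)"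
    if i: "i < n" for i
  proof -
    have "(\<Sum>j<m. \<bar>((1 - t) \<cdot>\<^sub>m P + t \<cdot>\<^sub>m Q) $$ (i, j)\<bar>)
        \<le> (\<Sum>j<m. (1 - t) * \<bar>P $$ (i, j)\<bar> + t * \<bar>Q $$ (i, j)\<bar>)"
      using car i t by (intro sum_mono) (auto intro: order.trans[OF abs_triangle_ineq] simp: abs_mult)
    also have "\<dots> = (1 - t) * (\<Sum>j<m. \<bar>P $$ (i, j)\<bar>) + t * (\<Sum>j<m. \<bar>Q $$ (i, j)\<bar>)"
      by (simp add: sum.distrib sum_distrib_left)
    also have "\<dots> \<le> (\<Sum>j<m. \<bar>Ss $$ (i, j)\<bar>)"
      using PQ i t by (intro convex_bound_le) (auto simp: mem_row_l1_set_iff[OF Ss])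
    finally show ?thesis .
  qed
  then show "(1 - t) \<cdot>\<^sub>m P + t \<cdot>\<^sub>m Q \<in> row_l1_set Ss"
    using car by (auto simp: mem_row_l1_set_iff[OF Ss])
qed

lemma two_inf_norm_le_iff:
  assumes "F \<in> carrier_mat n m" "0 < n"
  shows "two_inf_norm F \<le> b \<longleftrightarrow> (\<forall>i<n. L2_set (\<lambda>j. F $$ (i, j)) {..<m} \<le> b)"
proof -
  have "two_inf_norm F \<le> b \<longleftrightarrow> (\<forall>i<n. l2_norm (row F i) \<le> b)"
    using assms unfolding two_inf_norm_def by (subst Max_le_iff) auto
  then show ?thesis using assms by (simp add: l2_norm_row)
qed

lemma mem_incoherent_set_iff:
  assumes "F0 \<in> carrier_mat n m" "0 < n"
  shows "F \<in> incoherent_set \<mu> F0 \<longleftrightarrow> F \<in> carrier_mat n m \<and>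
    (\<forall>i<n. L2_set (\<lambda>j. F $$ (i, j)) {..<m} \<le> sqrt (2 * \<mu> / real n) * frob_norm F0)"
  using assms two_inf_norm_le_iff[of F n m] by (auto simp: incoherent_set_def)

lemma entrywise_closed_incoherent_set:
  assumes F0: "F0 \<in> carrier_mat n m" "0 < n"
  shows "entrywise_closed n m (incoherent_set \<mu> F0)"
  unfolding entrywise_closed_def
proof (intro conjI allI impI, goal_cases)
  case 1
  then show ?case by (auto simp: mem_incoherent_set_iff[OF F0])
next
  case (2 X A)
  have "L2_set (\<lambda>j. A $$ (i, j)) {..<m} \<le> sqrt (2 * \<mu> / real n) * frob_norm F0" if i: "i < n" for i
  proof (rule LIMSEQ_le_const2)
    show "(\<lambda>k. L2_set (\<lambda>j. X k $$ (i, j)) {..<m}) \<longlonglongrightarrow> L2_set (\<lambda>j. A $$ (i, j)) {..<m}"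
      unfolding L2_set_def using 2 i by (intro tendsto_intros) auto
    show "\<exists>N. \<forall>k\<ge>N. L2_set (\<lambda>j. X k $$ (i, j)) {..<m} \<le> sqrt (2 * \<mu> / real n) * frob_norm F0"
      using 2 i by (auto simp: mem_incoherent_set_iff[OF F0])
  qed
  then show ?case using 2 by (auto simp: mem_incoherent_set_iff[OF F0])
qed

lemma mat_convex_incoherent_set:
  assumes F0: "F0 \<in> carrier_mat n m" "0 < n"
  shows "mat_convex (incoherent_set \<mu> F0)"
  unfolding mat_convex_def
proof (intro ballI allI impI)
  fix P Q and t :: real
  assume PQ: "P \<in> incoherent_set \<mu> F0" "Q \<in> incoherent_set \<mu> F0" and t: "0 \<le> t \<and> t \<le> 1"
  have car: "P \<in> carrier_mat n m" "Q \<in> carrier_mat n m"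
    using PQ by (auto simp: mem_incoherent_set_iff[OF F0])
  have "L2_set (\<lambda>j. ((1 - t) \<cdot>\<^sub>m P + t \<cdot>\<^sub>m Q) $$ (i, j)) {..<m} \<le> sqrt (2 * \<mu> / real n) * frob_norm F0"
    if i: "i < n" for i
  proof -
    have "L2_set (\<lambda>j. ((1 - t) \<cdot>\<^sub>m P + t \<cdot>\<^sub>m Q) $$ (i, j)) {..<m}
        = L2_set (\<lambda>j. (1 - t) * P $$ (i, j) + t * Q $$ (i, j)) {..<m}"
      using car i by (intro L2_set_cong) auto
    also have "\<dots> \<le> L2_set (\<lambda>j. (1 - t) * P $$ (i, j)) {..<m} + L2_set (\<lambda>j. t * Q $$ (i, j)) {..<m}"
      by (rule L2_set_triangle_ineq)
    also have "\<dots> = (1 - t) * L2_set (\<lambda>j. P $$ (i, j)) {..<m} + t * L2_set (\<lambda>j. Q $$ (i, j)) {..<m}"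
      using t by (simp add: L2_set_right_distrib)
    also have "\<dots> \<le> sqrt (2 * \<mu> / real n) * frob_norm F0"
      using PQ i t by (intro convex_bound_le) (auto simp: mem_incoherent_set_iff[OF F0])
    finally show ?thesis .
  qed
  then show "(1 - t) \<cdot>\<^sub>m P + t \<cdot>\<^sub>m Q \<in> incoherent_set \<mu> F0"
    using car by (auto simp: mem_incoherent_set_iff[OF F0])
qed

section \<open>Row-sparse errors paired with matrices that have short rows\<close>

text \<open>The cone argument of sparse recovery: the l1 budget forces the mass of \<open>u\<close>
  off the support \<open>T\<close> of \<open>s\<close> to be at most the mass lost on
  \<open>T\<close>. So half of the l1 error sits on at most \<open>k\<close> indices, where
  Cauchy-Schwarz costs \<open>sqrt k\<close>.\<close>

lemma l1_diff_le_l2_diff: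
  fixes u s :: "'i \<Rightarrow> real"
  assumes "finite I" and l1: "(\<Sum>j\<in>I. \<bar>u j\<bar>) \<le> (\<Sum>j\<in>I. \<bar>s j\<bar>)"
    and card: "card {j\<in>I. s j \<noteq> 0} \<le> k"
  shows "(\<Sum>j\<in>I. \<bar>u j - s j\<bar>) \<le> 2 * sqrt k * L2_set (\<lambda>j. u j - s j) I"
proof -
  define T where "T = {j\<in>I. s j \<noteq> 0}"
  have T: "T \<subseteq> I" "finite T" using assms(1) by (auto simp: T_def)
  have split: "(\<Sum>j\<in>I. f j) = (\<Sum>j\<in>I - T. f j) + (\<Sum>j\<in>T. f j)" for f :: "'i \<Rightarrow> real"
    using T(1) assms(1) by (rule sum.subset_diff)
  have off: "(\<Sum>j\<in>I - T. \<bar>s j\<bar>) = 0" "(\<Sum>j\<in>I - T. \<bar>u j - s j\<bar>) = (\<Sum>j\<in>I - T. \<bar>u j\<bar>)"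
    by (auto simp: T_def intro!: sum.cong sum.neutral)
  have "(\<Sum>j\<in>T. \<bar>s j\<bar>) - (\<Sum>j\<in>T. \<bar>u j\<bar>) \<le> (\<Sum>j\<in>T. \<bar>u j - s j\<bar>)"
    unfolding sum_subtractf[symmetric] by (intro sum_mono) linarith
  then have "(\<Sum>j\<in>I. \<bar>u j - s j\<bar>) \<le> 2 * (\<Sum>j\<in>T. \<bar>u j - s j\<bar>)"
    using l1 split[of "\<lambda>j. \<bar>u j\<bar>"] split[of "\<lambda>j. \<bar>s j\<bar>"] split[of "\<lambda>j. \<bar>u j - s j\<bar>"] off by linarith
  also have "(\<Sum>j\<in>T. \<bar>u j - s j\<bar>) \<le> L2_set (\<lambda>j. u j - s j) T * L2_set (\<lambda>j. 1) T"
    using L2_set_mult_ineq[of "\<lambda>j. u j - s j" "\<lambda>j. 1" T] by simp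
  also have "\<dots> \<le> L2_set (\<lambda>j. u j - s j) I * sqrt k"
  proof (intro mult_mono)
    show "L2_set (\<lambda>j. u j - s j) T \<le> L2_set (\<lambda>j. u j - s j) I"
      unfolding L2_set_def using T assms(1) by (intro real_sqrt_le_mono sum_mono2) auto
    show "L2_set (\<lambda>j. 1) T \<le> sqrt k"
      using card by (simp add: L2_set_constant T_def)
  qed auto
  finally show ?thesis by (simp add: mult_ac)
qed

text \<open>Every entry in row \<open>i\<close> of \<open>D * A\<^sup>T\<close> is at most
  \<open>a\<close> times the length of row \<open>i\<close> of \<open>D\<close>. Pairing l1 with the
  maximum inside each row and applying Cauchy-Schwarz across the rows gives the bound.\<close>

lemma mat_inner_row_l1_bound:
  assumes X: "X \<in> carrier_mat n m" and D: "D \<in> carrier_mat n r" and A: "A \<in> carrier_mat m r"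
    and l1: "\<And>i. i < n \<Longrightarrow> (\<Sum>j<m. \<bar>X $$ (i, j)\<bar>) \<le> \<kappa> * l2_norm (row X i)"
    and a: "\<And>j. j < m \<Longrightarrow> l2_norm (row A j) \<le> a" and nn: "0 \<le> a" "0 \<le> \<kappa>"
  shows "\<bar>mat_inner X (D * A\<^sup>T)\<bar> \<le> \<kappa> * a * frob_norm X * frob_norm D"
proof -
  have nonneg: "0 \<le> l2_norm v" for v by (simp add: l2_norm_def sum_nonneg)
  have ent: "\<bar>(D * A\<^sup>T) $$ (i, j)\<bar> \<le> l2_norm (row D i) * a" if ij: "i < n" "j < m" for i j
  proof -
    have "\<bar>(D * A\<^sup>T) $$ (i, j)\<bar> = \<bar>\<Sum>l<r. D $$ (i, l) * A $$ (j, l)\<bar>"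
      using index_mult_mat_sum[of D n r "A\<^sup>T" m i j] D A ij by (simp del: index_mult_mat)
    also have "\<dots> \<le> (\<Sum>l<r. \<bar>D $$ (i, l)\<bar> * \<bar>A $$ (j, l)\<bar>)"
      by (rule order.trans[OF sum_abs]) (simp add: abs_mult)
    also have "\<dots> \<le> l2_norm (row D i) * l2_norm (row A j)"
      using L2_set_mult_ineq D A ij by (simp add: l2_norm_row)
    also have "\<dots> \<le> l2_norm (row D i) * a"
      using a ij nonneg by (intro mult_left_mono) auto
    finally show ?thesis .
  qed
  have "\<bar>mat_inner X (D * A\<^sup>T)\<bar> \<le> (\<Sum>i<n. \<Sum>j<m. \<bar>X $$ (i, j)\<bar> * \<bar>(D * A\<^sup>T) $$ (i, j)\<bar>)"
    unfolding mat_inner_carrier[OF X]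
    by (rule order.trans[OF sum_abs sum_mono], rule order.trans[OF sum_abs]) (simp add: abs_mult)
  also have "\<dots> \<le> (\<Sum>i<n. \<Sum>j<m. \<bar>X $$ (i, j)\<bar> * (l2_norm (row D i) * a))"
    by (intro sum_mono mult_left_mono ent) auto
  also have "\<dots> = (\<Sum>i<n. (\<Sum>j<m. \<bar>X $$ (i, j)\<bar>) * (l2_norm (row D i) * a))"
    by (simp add: sum_distrib_right)
  also have "\<dots> \<le> (\<Sum>i<n. (\<kappa> * l2_norm (row X i)) * (l2_norm (row D i) * a))"
    using l1 nn nonneg by (intro sum_mono mult_right_mono) auto
  also have "\<dots> = \<kappa> * a * (\<Sum>i<n. \<bar>l2_norm (row X i)\<bar> * \<bar>l2_norm (row D i)\<bar>)"
    using nonneg by (simp add: sum_distrib_left mult_ac)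
  also have "\<dots> \<le> \<kappa> * a * (frob_norm X * frob_norm D)"
    unfolding frob_norm_rows[OF X] frob_norm_rows[OF D]
    using nn by (intro mult_left_mono L2_set_mult_ineq) auto
  finally show ?thesis by (simp add: mult_ac)
qed

section \<open>Orthogonal factors\<close>

text \<open>Rank is subadditive and an outer product has rank at most one.\<close>

lemma rank_sum_outer_le:
  fixes f g :: "'l \<Rightarrow> nat \<Rightarrow> real"
  assumes "finite J"
  shows "vec_space.rank n (mat n m (\<lambda>(i, j). \<Sum>l\<in>J. f l i * g l j)) \<le> card J"
  using assms
proof (induction J rule: finite_induct)
  case empty
  interpret vec_space "TYPE(real)" n .
  have "mat n m (\<lambda>(i, j). \<Sum>l\<in>{}. f l i * g l j) = 0\<^sub>m n m"
    by (intro eq_matI) auto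
  then show ?case using rank_0I[of m] by (simp only: card.empty)
next
  case (insert a J)
  interpret vec_space "TYPE(real)" n .
  let ?A = "mat n m (\<lambda>(i, j). f a i * g a j)" and ?B = "mat n m (\<lambda>(i, j). \<Sum>l\<in>J. f l i * g l j)"
  have "mat n m (\<lambda>(i, j). \<Sum>l\<in>insert a J. f l i * g l j) = ?A + ?B"
    using insert.hyps by (intro eq_matI) auto
  moreover have "rank ?A \<le> 1"
    by (rule rank_le_1_product_entries[where nc = m and f = "f a" and g = "g a"]) auto
  moreover have "rank (?A + ?B) \<le> rank ?A + rank ?B"
    by (rule rank_subadditive[where nc = m]) auto
  ultimately show ?case using insert by simp
qed

lemma col_scalar_prod_sum:
  assumes "A \<in> carrier_mat d r" "l < r" "l' < r"
  shows "col A l \<bullet> col A l' = (\<Sum>i<d. A $$ (i, l) * A $$ (i, l'))"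
  using assms by (auto simp: scalar_prod_def lessThan_atLeast0 intro!: sum.cong)

lemma index_mult_transpose_sum:
  assumes "A \<in> carrier_mat d r" "i < d" "j < d"
  shows "(A * A\<^sup>T) $$ (i, j) = (\<Sum>l<r. A $$ (i, l) * A $$ (j, l))"
  using index_mult_mat_sum[of A d r "A\<^sup>T" d i j] assms by (simp del: index_mult_mat)

text \<open>If column \<open>j\<close> vanished, \<open>A * A\<^sup>T\<close> would be a sum of
  \<open>r - 1\<close> outer products, which contradicts rank \<open>r\<close>.\<close>

lemma orth_factor_col_nonzero:
  fixes A :: "real mat"
  assumes A: "A \<in> carrier_mat d r" and rank: "vec_space.rank d (A * A\<^sup>T) = r" and j: "j < r"
  shows "0 < col A j \<bullet> col A j"
proof (rule ccontr)
  assume "\<not> 0 < col A j \<bullet> col A j"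
  then have "(\<Sum>i<d. A $$ (i, j) * A $$ (i, j)) \<le> 0"
    using col_scalar_prod_sum[OF A j j] by simp
  then have "(\<Sum>i<d. A $$ (i, j) * A $$ (i, j)) = 0"
    by (simp add: antisym sum_nonneg)
  then have zero: "A $$ (i, j) = 0" if "i < d" for i
    using that by (simp add: sum_nonneg_eq_0_iff)
  have "A * A\<^sup>T = mat d d (\<lambda>(i, j'). \<Sum>l\<in>{..<r} - {j}. A $$ (i, l) * A $$ (j', l))"
  proof (rule eq_matI)
    fix i j' assume "i < dim_row (mat d d (\<lambda>(i, j'). \<Sum>l\<in>{..<r} - {j}. A $$ (i, l) * A $$ (j', l)))"
      "j' < dim_col (mat d d (\<lambda>(i, j'). \<Sum>l\<in>{..<r} - {j}. A $$ (i, l) * A $$ (j', l)))"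
    then show "(A * A\<^sup>T) $$ (i, j') = mat d d (\<lambda>(i, j'). \<Sum>l\<in>{..<r} - {j}. A $$ (i, l) * A $$ (j', l)) $$ (i, j')"
      using j zero index_mult_transpose_sum[OF A, of i j']
      by (simp add: sum.remove[of "{..<r}" j] del: index_mult_mat)
  qed (use A in auto)
  then have "vec_space.rank d (A * A\<^sup>T) \<le> card ({..<r} - {j})"
    using rank_sum_outer_le[of "{..<r} - {j}" d d "\<lambda>l i. A $$ (i, l)" "\<lambda>l i. A $$ (i, l)"] by simp
  then show False using rank j by simp
qed

text \<open>Orthogonality leaves \<open>A\<^sup>T *\<^sub>v col A j\<close> with its entry
  \<open>j\<close> as the only possibly nonzero one, so \<open>col A j\<close> is itself an
  eigenvector.\<close>

lemma orth_factor_eigenvalue: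
  fixes A :: "real mat"
  assumes A: "A \<in> carrier_mat d r" and orth: "\<forall>i<r. \<forall>j<r. i \<noteq> j \<longrightarrow> col A i \<bullet> col A j = 0"
    and j: "j < r" and pos: "0 < col A j \<bullet> col A j"
  shows "eigenvalue (A * A\<^sup>T) (col A j \<bullet> col A j)"
proof -
  have "col A j \<noteq> 0\<^sub>v d"
    using pos by auto
  moreover have "(A * A\<^sup>T) *\<^sub>v col A j = (col A j \<bullet> col A j) \<cdot>\<^sub>v col A j"
  proof (rule eq_vecI)
    fix i assume "i < dim_vec ((col A j \<bullet> col A j) \<cdot>\<^sub>v col A j)"
    then have i: "i < d" using A by simp
    have "(A * A\<^sup>T) *\<^sub>v col A j = A *\<^sub>v (A\<^sup>T *\<^sub>v col A j)"
      using A by (intro assoc_mult_mat_vec) auto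
    then have "((A * A\<^sup>T) *\<^sub>v col A j) $ i = (\<Sum>l<r. A $$ (i, l) * (col A l \<bullet> col A j))"
      using A i by (auto simp: scalar_prod_def[of "row A i"] lessThan_atLeast0 intro!: sum.cong)
    also have "\<dots> = A $$ (i, j) * (col A j \<bullet> col A j)"
      using orth j by (simp add: sum.remove[of "{..<r}" j])
    finally show "((A * A\<^sup>T) *\<^sub>v col A j) $ i = ((col A j \<bullet> col A j) \<cdot>\<^sub>v col A j) $ i"
      using A i j by simp
  qed (use A in simp)
  ultimately show ?thesis
    using A unfolding eigenvalue_def eigenvector_def by (intro exI[of _ "col A j"]) auto
qed

text \<open>Squared column lengths of a factor are nonzero eigenvalues of \<open>M\<close>, hence
  all equal. They depend on \<open>M\<close> alone, so a single \<open>s\<close> serves every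
  factor.\<close>

lemma orth_factors_gram:
  assumes r: "0 < r" and ne: "orth_factors r M \<noteq> {}"
    and rank: "vec_space.rank (dim_row M) M = r" and ev: "equal_nonzero_eigenvalues M"
  obtains s where "0 < s" "\<And>A. A \<in> orth_factors r M \<Longrightarrow> A\<^sup>T * A = s\<^sup>2 \<cdot>\<^sub>m 1\<^sub>m r"
proof -
  have col: "0 < col A j \<bullet> col A j" "eigenvalue M (col A j \<bullet> col A j)"
    if "A \<in> orth_factors r M" "j < r" for A j
    using that orth_factor_col_nonzero[of A "dim_row M" r j] orth_factor_eigenvalue[of A "dim_row M" r j] rank
    by (auto simp: orth_factors_def)
  obtain B where B: "B \<in> orth_factors r M" using ne by blast
  define s where "s = sqrt (col B 0 \<bullet> col B 0)"
  have s: "0 < s" "s\<^sup>2 = col B 0 \<bullet> col B 0"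
    using col(1)[OF B r] by (auto simp: s_def)
  have eq: "col A j \<bullet> col A j = s\<^sup>2" if "A \<in> orth_factors r M" "j < r" for A j
  proof -
    have "col A j \<bullet> col A j = col B 0 \<bullet> col B 0"
      using col[OF that] col[OF B r] ev unfolding equal_nonzero_eigenvalues_def
      by (metis less_irrefl)
    then show ?thesis using s by simp
  qed
  have "A\<^sup>T * A = s\<^sup>2 \<cdot>\<^sub>m 1\<^sub>m r" if A: "A \<in> orth_factors r M" for A
    using A eq[OF A] by (intro eq_matI) (auto simp: orth_factors_def)
  with s(1) show thesis by (rule that)
qed

text \<open>The Gram identity makes \<open>A\<close> scale every vector by exactly \<open>s\<close>,
  so the supremum is attained at a unit vector.\<close>

lemma spectral_norm_semi_orth:
  assumes A: "A \<in> carrier_mat d r" and gram: "A\<^sup>T * A = s\<^sup>2 \<cdot>\<^sub>m 1\<^sub>m r" and s: "0 \<le> s" and r: "0 < r"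
  shows "spectral_norm A = s"
proof -
  have sq: "(l2_norm v)\<^sup>2 = v \<bullet> v" for v
    by (simp add: l2_norm_def sum_nonneg scalar_prod_def power2_eq_square lessThan_atLeast0)
  have nn: "0 \<le> l2_norm v" for v by (simp add: l2_norm_def sum_nonneg)
  have eq: "l2_norm (A *\<^sub>v x) = s * l2_norm x" if x: "x \<in> carrier_vec r" for x
  proof -
    have "(l2_norm (A *\<^sub>v x))\<^sup>2 = (A *\<^sub>v x) \<bullet> (A *\<^sub>v x)" by (rule sq)
    also have "\<dots> = x \<bullet> (A\<^sup>T *\<^sub>v (A *\<^sub>v x))"
      using A x transpose_vec_mult_scalar[of A d r x "A *\<^sub>v x"]
        comm_scalar_prod[of x r "A\<^sup>T *\<^sub>v (A *\<^sub>v x)"] by simp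
    also have "A\<^sup>T *\<^sub>v (A *\<^sub>v x) = s\<^sup>2 \<cdot>\<^sub>v x"
      using A x gram
      by (simp add: assoc_mult_mat_vec[symmetric, of _ r d _ r])
         (intro eq_vecI; simp add: smult_scalar_prod_distrib[of _ r] row_smult)
    also have "x \<bullet> (s\<^sup>2 \<cdot>\<^sub>v x) = (s * l2_norm x)\<^sup>2"
      using x by (simp add: sq power_mult_distrib)
    finally show ?thesis
      using s nn by (simp add: power2_eq_iff_nonneg)
  qed
  have unit: "unit_vec r 0 \<in> carrier_vec r" "l2_norm (unit_vec r 0) = 1"
    using sq[of "unit_vec r 0"] r nn[of "unit_vec r 0"] by (auto simp: power2_eq_1_iff)
  show ?thesis
    unfolding spectral_norm_def
  proof (rule cSup_eq_maximum)
    show "s \<in> (\<lambda>x. l2_norm (A *\<^sub>v x)) ` {x \<in> carrier_vec (dim_col A). l2_norm x \<le> 1}"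
      using unit eq[OF unit(1)] A by (intro image_eqI[of _ _ "unit_vec r 0"]) auto
    show "y \<le> s" if "y \<in> (\<lambda>x. l2_norm (A *\<^sub>v x)) ` {x \<in> carrier_vec (dim_col A). l2_norm x \<le> 1}" for y
      using that A eq s by (auto intro: mult_left_le)
  qed
qed

section \<open>Closedness of the set of factors and invariants shared by all factors\<close>

text \<open>Membership amounts to finitely many polynomial equations in the entries, and these
  survive limits.\<close>

lemma entrywise_closed_orth_factors:
  assumes M: "M \<in> carrier_mat d d"
  shows "entrywise_closed d r (orth_factors r M)"
proof -
  have iff: "A \<in> orth_factors r M \<longleftrightarrow> A \<in> carrier_mat d r \<and>
      (\<forall>i<d. \<forall>j<d. (\<Sum>l<r. A $$ (i, l) * A $$ (j, l)) = M $$ (i, j)) \<and>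
      (\<forall>l<r. \<forall>l'<r. l \<noteq> l' \<longrightarrow> (\<Sum>i<d. A $$ (i, l) * A $$ (i, l')) = 0)" for A
  proof (cases "A \<in> carrier_mat d r")
    case True
    have "A * A\<^sup>T = M \<longleftrightarrow> (\<forall>i<d. \<forall>j<d. (A * A\<^sup>T) $$ (i, j) = M $$ (i, j))"
      using True M by (auto intro!: eq_matI simp del: index_mult_mat(1))
    then show ?thesis
      using True M index_mult_transpose_sum[OF True] col_scalar_prod_sum[OF True]
      by (auto simp: orth_factors_def simp del: index_mult_mat(1))
  qed (use M in \<open>auto simp: orth_factors_def\<close>)
  show ?thesis
    unfolding entrywise_closed_def
  proof (intro conjI allI impI, goal_cases)
    case 1
    then show ?case by (auto simp: iff)
  next
    case (2 X A)
    have "(\<Sum>l<r. A $$ (i, l) * A $$ (j, l)) = M $$ (i, j)" if ij: "i < d" "j < d" for i j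
    proof (rule LIMSEQ_unique)
      show "(\<lambda>k. \<Sum>l<r. X k $$ (i, l) * X k $$ (j, l)) \<longlonglongrightarrow> (\<Sum>l<r. A $$ (i, l) * A $$ (j, l))"
        using 2 ij by (intro tendsto_intros) auto
      show "(\<lambda>k. \<Sum>l<r. X k $$ (i, l) * X k $$ (j, l)) \<longlonglongrightarrow> M $$ (i, j)"
        using 2 ij by (simp add: iff)
    qed
    moreover have "(\<Sum>i<d. A $$ (i, l) * A $$ (i, l')) = 0" if ll: "l < r" "l' < r" "l \<noteq> l'" for l l'
    proof (rule LIMSEQ_unique)
      show "(\<lambda>k. \<Sum>i<d. X k $$ (i, l) * X k $$ (i, l')) \<longlonglongrightarrow> (\<Sum>i<d. A $$ (i, l) * A $$ (i, l'))"
        using 2 ll by (intro tendsto_intros) auto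
      show "(\<lambda>k. \<Sum>i<d. X k $$ (i, l) * X k $$ (i, l')) \<longlonglongrightarrow> 0"
        using 2 ll by (simp add: iff)
    qed
    ultimately show ?case using 2 by (auto simp: iff)
  qed
qed

text \<open>All factors share the norm given by the trace of \<open>M\<close>; minimizing the
  distance to \<open>F\<close> over them is therefore maximizing the inner product with
  \<open>F\<close>.\<close>

lemma orth_factors_frob_norm_sq:
  assumes "A \<in> orth_factors r M"
  shows "(frob_norm A)\<^sup>2 = (\<Sum>i<dim_row M. M $$ (i, i))"
proof -
  have A: "A \<in> carrier_mat (dim_row M) r" "A * A\<^sup>T = M"
    using assms by (auto simp: orth_factors_def)
  have "(frob_norm A)\<^sup>2 = (\<Sum>i<dim_row M. (A * A\<^sup>T) $$ (i, i))"
    using index_mult_transpose_sum[OF A(1)]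
    by (simp flip: mat_inner_self add: mat_inner_carrier[OF A(1)] del: index_mult_mat)
  then show ?thesis using A(2) by simp
qed

text \<open>Row lengths are read off the diagonal of \<open>M\<close>, so the incoherence of
  \<open>Fs\<close> passes to every other factor.\<close>

lemma orth_factors_row_norm:
  assumes "A \<in> orth_factors r M" "j < dim_row M"
  shows "l2_norm (row A j) = sqrt (M $$ (j, j))"
proof -
  have A: "A \<in> carrier_mat (dim_row M) r" "A * A\<^sup>T = M"
    using assms by (auto simp: orth_factors_def)
  have "M $$ (j, j) = (\<Sum>l<r. A $$ (j, l) * A $$ (j, l))"
    using index_mult_transpose_sum[OF A(1) assms(2,2)] A(2) by simp
  then show ?thesis using l2_norm_row[OF A(1) assms(2)] by (simp add: L2_set_def power2_eq_square)
qed

section \<open>Rotations of factors and optimality of the closest factor\<close>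

text \<open>Right multiplication of \<open>A\<close> by a Givens rotation in the plane of columns
  \<open>p, q\<close>, with \<open>c\<close> and \<open>s\<close> as cosine and sine; a genuine
  rotation once \<open>p \<noteq> q\<close> and \<open>c\<^sup>2 + s\<^sup>2 = 1\<close>.\<close>

definition givens :: "nat \<Rightarrow> nat \<Rightarrow> real \<Rightarrow> real \<Rightarrow> real mat \<Rightarrow> real mat" where
  "givens p q c s A = mat (dim_row A) (dim_col A) (\<lambda>(i, l).
     (if l = p \<or> l = q then c else 1) * A $$ (i, l)
     + (if l = p then s * A $$ (i, q) else if l = q then - s * A $$ (i, p) else 0))"

text \<open>An orthogonal matrix on the right cancels in \<open>A * A\<^sup>T\<close>. The columns
  stay orthogonal because the Gram matrix is a multiple of the identity: this is where equal
  eigenvalues matter, since rotating orthogonal columns of different lengths can destroy their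
  orthogonality.\<close>

lemma givens_orth_factors:
  assumes A: "A \<in> orth_factors r M" and gram: "A\<^sup>T * A = g \<cdot>\<^sub>m 1\<^sub>m r"
    and pq: "p < r" "q < r" "p \<noteq> q" and cs: "c\<^sup>2 + s\<^sup>2 = 1"
  shows "givens p q c s A \<in> orth_factors r M"
proof -
  define d where "d = dim_row M"
  let ?B = "givens p q c s A"
  have Ac: "A \<in> carrier_mat d r" and AM: "A * A\<^sup>T = M"
    using A by (auto simp: orth_factors_def d_def)
  have Bc: "?B \<in> carrier_mat d r" using Ac by (auto simp: givens_def)
  have cs': "c * c + s * s = 1" using cs by (simp add: power2_eq_square)
  have split: "(\<Sum>l<r. f l) = f p + (f q + (\<Sum>l\<in>{..<r} - {p} - {q}. f l))" for f :: "nat \<Rightarrow> real"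
    using pq by (simp add: sum.remove[of "{..<r}" p] sum.remove[of "{..<r} - {p}" q])
  have "?B * ?B\<^sup>T = A * A\<^sup>T"
  proof (rule eq_matI)
    fix i j assume "i < dim_row (A * A\<^sup>T)" "j < dim_col (A * A\<^sup>T)"
    then have ij: "i < d" "j < d" using Ac by auto
    have rest: "(\<Sum>l\<in>{..<r} - {p} - {q}. ?B $$ (i, l) * ?B $$ (j, l))
        = (\<Sum>l\<in>{..<r} - {p} - {q}. A $$ (i, l) * A $$ (j, l))"
      using Ac ij by (intro sum.cong) (auto simp: givens_def)
    have "?B $$ (i, p) * ?B $$ (j, p) + ?B $$ (i, q) * ?B $$ (j, q)
        = (c * A $$ (i, p) + s * A $$ (i, q)) * (c * A $$ (j, p) + s * A $$ (j, q))
          + (c * A $$ (i, q) - s * A $$ (i, p)) * (c * A $$ (j, q) - s * A $$ (j, p))"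
      using Ac ij pq by (simp add: givens_def)
    also have "\<dots> = (c * c + s * s) * (A $$ (i, p) * A $$ (j, p) + A $$ (i, q) * A $$ (j, q))"
      by (simp add: algebra_simps)
    finally have "(\<Sum>l<r. ?B $$ (i, l) * ?B $$ (j, l)) = (\<Sum>l<r. A $$ (i, l) * A $$ (j, l))"
      unfolding split rest using cs' by simp
    then show "(?B * ?B\<^sup>T) $$ (i, j) = (A * A\<^sup>T) $$ (i, j)"
      using index_mult_transpose_sum[OF Bc ij] index_mult_transpose_sum[OF Ac ij] by simp
  qed (use Ac Bc in auto)
  moreover have "col ?B l \<bullet> col ?B l' = 0" if ll: "l < r" "l' < r" "l \<noteq> l'" for l l'
  proof -
    define h where "h l l' = (\<Sum>i<d. A $$ (i, l) * A $$ (i, l'))" for l l'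
    have h: "h l l' = (if l = l' then g else 0)" if "l < r" "l' < r" for l l'
    proof -
      have "h l l' = (A\<^sup>T * A) $$ (l, l')"
        using col_scalar_prod_sum[OF Ac that] Ac that by (simp add: h_def)
      then show ?thesis using gram that by simp
    qed
    \<comment> \<open>A uniform form for all columns: column \<open>l\<close> of the rotated matrix
      combines columns \<open>l\<close> and \<open>\<tau> l\<close>. Away from \<open>p\<close> and
      \<open>q\<close> the value of \<open>\<tau>\<close> is a dummy, since \<open>\<beta>\<close>
      is 0 there.\<close>
    define \<tau> where "\<tau> l = (if l = p then q else p)" for l
    define \<alpha> where "\<alpha> l = (if l = p \<or> l = q then c else 1)" for l
    define \<beta> where "\<beta> l = (if l = p then s else if l = q then - s else 0)" for l
    have \<tau>: "\<tau> l < r" for l using pq by (simp add: \<tau>_def)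
    have B: "?B $$ (i, l) = \<alpha> l * A $$ (i, l) + \<beta> l * A $$ (i, \<tau> l)" if "i < d" "l < r" for i l
      using Ac that pq by (simp add: givens_def \<alpha>_def \<beta>_def \<tau>_def)
    have "col ?B l \<bullet> col ?B l' = (\<Sum>i<d. ?B $$ (i, l) * ?B $$ (i, l'))"
      using col_scalar_prod_sum[OF Bc] ll by simp
    also have "\<dots> = \<alpha> l * \<alpha> l' * h l l' + \<alpha> l * \<beta> l' * h l (\<tau> l')
        + \<beta> l * \<alpha> l' * h (\<tau> l) l' + \<beta> l * \<beta> l' * h (\<tau> l) (\<tau> l')"
      using ll unfolding h_def sum_distrib_left sum.distrib[symmetric]
      by (intro sum.cong) (auto simp: B algebra_simps)
    also have "\<dots> = 0"
      using ll pq \<tau> by (auto simp: h \<alpha>_def \<beta>_def \<tau>_def)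
    finally show ?thesis .
  qed
  ultimately show ?thesis using Bc AM by (simp add: orth_factors_def d_def)
qed

text \<open>First-order optimality of the closest factor \<open>A\<close> along Givens rotations: the rotation of
  columns \<open>p, q\<close> by a small angle changes \<open>\<langle>F, A\<rangle>\<close> by the angle times the antisymmetric part of
  \<open>A\<^sup>T F\<close>, up to second order.\<close>

lemma closest_orth_factor_symmetric:
  assumes A: "A \<in> orth_factors r M" and gram: "A\<^sup>T * A = g \<cdot>\<^sub>m 1\<^sub>m r"
    and F: "F \<in> carrier_mat (dim_row M) r"
    and min: "\<And>B. B \<in> orth_factors r M \<Longrightarrow> frob_norm (F - A) \<le> frob_norm (F - B)"
  shows "(A\<^sup>T * F)\<^sup>T = A\<^sup>T * F"
proof -
  define d where "d = dim_row M"
  have Ac: "A \<in> carrier_mat d r" and Fc: "F \<in> carrier_mat d r"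
    using A F by (auto simp: orth_factors_def d_def)
  have le: "mat_inner F B \<le> mat_inner F A" if B: "B \<in> orth_factors r M" for B
  proof -
    have Bc: "B \<in> carrier_mat d r" using B by (auto simp: orth_factors_def d_def)
    have "(frob_norm (F - A))\<^sup>2 \<le> (frob_norm (F - B))\<^sup>2"
      using min[OF B] by (rule power_mono) simp
    then show ?thesis
      using orth_factors_frob_norm_sq[OF A] orth_factors_frob_norm_sq[OF B]
      by (simp add: frob_norm_minus_sq[OF Fc Ac] frob_norm_minus_sq[OF Fc Bc])
  qed
  define b where "b p q = (\<Sum>i<d. F $$ (i, p) * A $$ (i, q))" for p q
  \<comment> \<open>Exchanging \<open>p\<close> and \<open>q\<close> gives the reverse inequality,
    so one sign suffices for symmetry.\<close>
  have half: "b p q \<le> b q p" if pq: "p < r" "q < r" "p \<noteq> q" for p q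
  proof -
    have expand: "mat_inner F B = (\<Sum>i<d. F $$ (i, p) * B $$ (i, p)) + ((\<Sum>i<d. F $$ (i, q) * B $$ (i, q))
        + (\<Sum>l\<in>{..<r} - {p} - {q}. \<Sum>i<d. F $$ (i, l) * B $$ (i, l)))" for B
    proof -
      have "mat_inner F B = (\<Sum>l<r. \<Sum>i<d. F $$ (i, l) * B $$ (i, l))"
        unfolding mat_inner_carrier[OF Fc] by (rule sum.swap)
      then show ?thesis
        using pq by (simp add: sum.remove[of "{..<r}" p] sum.remove[of "{..<r} - {p}" q])
    qed
    have "b p q - b q p \<le> 0"
    proof (rule nonpos_if_linear_le_quadratic)
      fix t :: real assume t: "0 < t" "t \<le> 1"
      \<comment> \<open>The cosine belonging to the sine \<open>t\<close>. Since
        \<open>1 - c \<le> t\<^sup>2\<close>, the change on the diagonal is of second order.\<close>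
      define c where "c = sqrt (1 - t\<^sup>2)"
      have t1: "t\<^sup>2 \<le> 1" using t by (simp add: power_le_one)
      then have c: "c\<^sup>2 + t\<^sup>2 = 1" "0 \<le> c" by (auto simp: c_def)
      have "0 \<le> 1 - c" "1 - c \<le> t\<^sup>2"
      proof -
        have "c \<le> 1" by (simp add: c_def)
        then show "0 \<le> 1 - c" by simp
        have "c * c \<le> c * 1" using \<open>c \<le> 1\<close> c(2) by (rule mult_left_mono)
        then show "1 - c \<le> t\<^sup>2" using c(1) by (simp add: power2_eq_square)
      qed
      let ?B = "givens p q c t A"
      have rest: "(\<Sum>l\<in>{..<r} - {p} - {q}. \<Sum>i<d. F $$ (i, l) * ?B $$ (i, l))
          = (\<Sum>l\<in>{..<r} - {p} - {q}. \<Sum>i<d. F $$ (i, l) * A $$ (i, l))"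
        using Ac by (intro sum.cong) (auto simp: givens_def)
      have P: "(\<Sum>i<d. F $$ (i, p) * ?B $$ (i, p)) = c * b p p + t * b p q"
        unfolding b_def sum_distrib_left sum.distrib[symmetric]
        using Ac pq by (intro sum.cong) (auto simp: givens_def algebra_simps)
      have Q: "(\<Sum>i<d. F $$ (i, q) * ?B $$ (i, q)) = c * b q q - t * b q p"
        unfolding b_def sum_distrib_left sum_subtractf[symmetric]
        using Ac pq by (intro sum.cong) (auto simp: givens_def algebra_simps)
      have "mat_inner F ?B \<le> mat_inner F A"
        using givens_orth_factors[OF A gram pq c(1)] by (rule le)
      then have "c * b p p + t * b p q + (c * b q q - t * b q p) \<le> b p p + b q q"
        unfolding expand rest P Q by (simp add: b_def)
      then have "t * (b p q - b q p) \<le> (1 - c) * (b p p + b q q)"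
        by (simp add: algebra_simps)
      also have "\<dots> \<le> (1 - c) * \<bar>b p p + b q q\<bar>"
        using \<open>0 \<le> 1 - c\<close> by (intro mult_left_mono) auto
      also have "\<dots> \<le> t\<^sup>2 * \<bar>b p p + b q q\<bar>"
        using \<open>1 - c \<le> t\<^sup>2\<close> by (intro mult_right_mono) auto
      finally show "t * (b p q - b q p) \<le> t\<^sup>2 * \<bar>b p p + b q q\<bar>" .
    qed
    then show ?thesis by simp
  qed
  have entry: "(A\<^sup>T * F) $$ (p, q) = b q p" if "p < r" "q < r" for p q
    using index_mult_mat_sum[of "A\<^sup>T" r d F r p q] Ac Fc that
    by (simp add: b_def mult.commute del: index_mult_mat)
  show ?thesis
  proof (rule eq_matI)
    fix p q assume "p < dim_row (A\<^sup>T * F)" "q < dim_col (A\<^sup>T * F)"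
    then have pq: "p < r" "q < r" using Ac Fc by auto
    have "b p q = b q p"
      using half[of p q] half[of q p] pq by (cases "p = q") auto
    then show "(A\<^sup>T * F)\<^sup>T $$ (p, q) = (A\<^sup>T * F) $$ (p, q)"
      using entry[OF pq] entry[of q p] pq Ac Fc by (simp del: index_mult_mat(1))
  qed (use Ac Fc in auto)
qed

text \<open>Closedness of the set of factors turns the infimum into a minimum. The one-step analysis
  works with this \<open>A\<close>, whose optimality makes \<open>A\<^sup>T * F\<close>
  symmetric.\<close>

lemma factor_dist_attained:
  assumes Fs: "Fs \<in> orth_factors r M" and M: "M = Fs * Fs\<^sup>T" and F: "F \<in> carrier_mat (dim_row Fs) r"
  obtains A where "A \<in> orth_factors r M" "factor_dist F Fs = frob_norm (F - A)"
    "\<And>B. B \<in> orth_factors r M \<Longrightarrow> frob_norm (F - A) \<le> frob_norm (F - B)"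
proof -
  have c: "dim_col Fs = r" "M \<in> carrier_mat (dim_row Fs) (dim_row Fs)"
  proof -
    show "dim_col Fs = r" using F Fs unfolding orth_factors_def by blast
    show "M \<in> carrier_mat (dim_row Fs) (dim_row Fs)" unfolding M by (intro mult_carrier_mat) auto
  qed
  obtain A where A: "A \<in> orth_factors r M"
    "\<And>B. B \<in> orth_factors r M \<Longrightarrow> frob_norm (F - A) \<le> frob_norm (F - B)"
    using ex_closest_point[OF entrywise_closed_orth_factors[OF c(2)] _ F] Fs by blast
  moreover have "factor_dist F Fs = frob_norm (F - A)"
    unfolding factor_dist_def c(1) M[symmetric] using A by (intro cInf_eq_minimum) auto
  ultimately show thesis by (intro that)
qed

lemma factor_dist_le:
  assumes "A \<in> orth_factors (dim_col Fs) (Fs * Fs\<^sup>T)"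
  shows "factor_dist F Fs \<le> frob_norm (F - A)"
  unfolding factor_dist_def using assms by (intro cINF_lower bdd_belowI2[of _ 0]) auto

section \<open>One gradient step\<close>

lemma frob_norm_minus_commute:
  assumes "A \<in> carrier_mat n m" "B \<in> carrier_mat n m"
  shows "frob_norm (A - B) = frob_norm (B - A)"
  using frob_norm_minus_sq[OF assms] frob_norm_minus_sq[OF assms(2,1)] mat_inner_commute[OF assms]
  by (simp add: power2_eq_iff_nonneg[symmetric])

text \<open>With \<open>P = D A\<^sup>T\<close>, \<open>W = D D\<^sup>T\<close> and
  \<open>H = A\<^sup>T D\<close>, symmetry of \<open>H\<close> turns the pairing of
  \<open>P\<^sup>T\<close> with \<open>P\<close> into the square of \<open>frob_norm H\<close>. This
  nonnegative term absorbs the only term of uncertain sign, the cubic pairing of \<open>P\<close>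
  with \<open>W\<close>.\<close>

lemma factor_curvature:
  assumes A: "A \<in> carrier_mat d r" and D: "D \<in> carrier_mat d r" and gram: "A\<^sup>T * A = s\<^sup>2 \<cdot>\<^sub>m 1\<^sub>m r"
    and sym: "(A\<^sup>T * D)\<^sup>T = A\<^sup>T * D" and small: "frob_norm D \<le> s / 5"
  shows "91/100 * (s * frob_norm D)\<^sup>2
    \<le> mat_inner (D * A\<^sup>T + A * D\<^sup>T + D * D\<^sup>T) (D * A\<^sup>T + D * D\<^sup>T)"
proof -
  define P W H where "P = D * A\<^sup>T" and "W = D * D\<^sup>T" and "H = A\<^sup>T * D"
  have car: "P \<in> carrier_mat d d" "W \<in> carrier_mat d d" "H \<in> carrier_mat r r"
    using A D by (auto simp: P_def W_def H_def)
  have PT: "P\<^sup>T = A * D\<^sup>T" and WT: "W\<^sup>T = W"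
    using A D by (simp_all add: P_def W_def transpose_mult[of D d r _ d])
  have HT: "D\<^sup>T * A = H"
    using sym A D by (simp add: H_def transpose_mult[of "A\<^sup>T" r d D r])
  have "mat_inner P\<^sup>T W = mat_inner P W"
    using mat_inner_transpose[of P d d W] car WT by simp
  then have expand: "mat_inner (P + P\<^sup>T + W) (P + W)
      = (frob_norm P)\<^sup>2 + mat_inner P\<^sup>T P + 3 * mat_inner P W + (frob_norm W)\<^sup>2"
    using car mat_inner_commute[of P d d W]
    by (simp flip: mat_inner_self add: mat_inner_add_left[of _ d d] mat_inner_add_right[of _ d d])
  have P: "(frob_norm P)\<^sup>2 = (s * frob_norm D)\<^sup>2"
    using frob_norm_mult_transpose_semi_orth[OF A gram D] by (simp add: P_def power_mult_distrib)
  have PP: "mat_inner P\<^sup>T P = (frob_norm H)\<^sup>2"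
  proof -
    have "mat_inner P\<^sup>T P = mat_inner D\<^sup>T (A\<^sup>T * P)"
      unfolding PT using A D car by (intro mat_inner_mult_left_adjoint) auto
    also have "A\<^sup>T * P = H * A\<^sup>T"
      using A D by (simp add: P_def H_def assoc_mult_mat[of _ r d D r _ d])
    also have "mat_inner D\<^sup>T (H * A\<^sup>T) = mat_inner (D\<^sup>T * A) H"
      using A D car by (intro mat_inner_mult_right_adjoint[symmetric]) auto
    finally show ?thesis by (simp add: HT mat_inner_self)
  qed
  have "mat_inner P W = mat_inner D (D * H)"
  proof -
    have "mat_inner P W = mat_inner D (W * A)"
      unfolding P_def using A D car mat_inner_mult_right_adjoint[of D d r "A\<^sup>T" d W] by simp
    also have "W * A = D * H"
      using A D by (simp add: W_def HT assoc_mult_mat[of D d r _ d A r])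
    finally show ?thesis .
  qed
  then have "\<bar>mat_inner P W\<bar> \<le> (frob_norm D)\<^sup>2 * frob_norm H"
    using mat_inner_cauchy_schwarz[of D d r "D * H"] frob_norm_mult_le[of D d r H r] D car
    by (simp add: order.trans[OF _ mult_left_mono] power2_eq_square mult.assoc)
  moreover have "(frob_norm D)\<^sup>2 * (frob_norm D)\<^sup>2 \<le> (s * frob_norm D)\<^sup>2 / 25"
  proof -
    have "(frob_norm D)\<^sup>2 \<le> (s / 5)\<^sup>2" using small by (intro power_mono) auto
    then have "(frob_norm D)\<^sup>2 * (frob_norm D)\<^sup>2 \<le> (s / 5)\<^sup>2 * (frob_norm D)\<^sup>2"
      by (rule mult_right_mono) simp
    then show ?thesis by (simp add: power_divide power_mult_distrib)
  qed
  \<comment> \<open>Completing the square uses up all of the \<open>H\<close> term. The quartic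
    remainder costs \<open>9/4 * 1/25 = 9/100\<close> of the leading term, hence the constant
    91/100.\<close>
  moreover have "3 * ((frob_norm D)\<^sup>2 * frob_norm H) \<le> (frob_norm H)\<^sup>2 + 9/4 * ((frob_norm D)\<^sup>2 * (frob_norm D)\<^sup>2)"
    using zero_le_power2[of "frob_norm H - 3/2 * (frob_norm D)\<^sup>2"]
    by (simp add: power2_eq_square algebra_simps)
  ultimately have "91/100 * (s * frob_norm D)\<^sup>2 \<le> mat_inner (P + P\<^sup>T + W) (P + W)"
    unfolding expand P PP using zero_le_power2[of "frob_norm W"]
    by linarith
  then show ?thesis unfolding PT unfolding P_def W_def .
qed

text \<open>The search direction is \<open>G F\<close> and not \<open>(G + G\<^sup>T) F\<close>, so only \<open>\<langle>G, (F - A) F\<^sup>T\<rangle>\<close> occurs. Against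
  the row-sparse error \<open>S' - Ss\<close> of the projection, the part \<open>(F - A) A\<^sup>T\<close> is small because the rows
  of \<open>A\<close> are, and the remaining part is quadratic in \<open>F - A\<close>; no incoherence of \<open>F\<close> is required.\<close>

lemma factored_grad_bounds:
  assumes A: "A \<in> carrier_mat d r" and F: "F \<in> carrier_mat d r" and gram: "A\<^sup>T * A = s\<^sup>2 \<cdot>\<^sub>m 1\<^sub>m r"
    and s: "0 < s" and sym: "(A\<^sup>T * F)\<^sup>T = A\<^sup>T * F" and small: "frob_norm (F - A) \<le> s / 5"
    and Ss: "Ss \<in> carrier_mat d d"
    and sparse: "\<And>i. i < d \<Longrightarrow> card {j. j < d \<and> Ss $$ (i, j) \<noteq> 0} \<le> k"
    and E: "E \<in> carrier_mat d d" and Y: "Y = A * A\<^sup>T + Ss + E"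
    and a: "\<And>j. j < d \<Longrightarrow> l2_norm (row A j) \<le> a" "0 \<le> a" "a * sqrt k \<le> s / 100"
  defines "\<delta> \<equiv> frob_norm (F - A)"
    and "G \<equiv> frob_proj (row_l1_set Ss) (Y - F * F\<^sup>T) - (Y - F * F\<^sup>T)"
  shows "42/100 * (s * \<delta>)\<^sup>2 - 3/2 * (s * \<delta>) * frob_norm E \<le> mat_inner (G * F) (F - A)"
    and "frob_norm (G * F) \<le> 6/5 * s * (11/5 * (s * \<delta>) + frob_norm E)"
proof -
  define D where "D = F - A"
  define P W where "P = D * A\<^sup>T" and "W = D * D\<^sup>T"
  define X where "X = Y - F * F\<^sup>T"
  define S where "S = frob_proj (row_l1_set Ss) X"
  define R where "R = P + P\<^sup>T + W"
  have Dc: "D \<in> carrier_mat d r" using A F by (simp add: D_def)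
  have FD: "F = A + D" using A F by (intro eq_matI) (auto simp: D_def)
  have car: "P \<in> carrier_mat d d" "W \<in> carrier_mat d d" "X \<in> carrier_mat d d" "R \<in> carrier_mat d d"
    using A F Dc E Y Ss by (auto simp: P_def W_def X_def R_def)
  have PT: "P\<^sup>T = A * D\<^sup>T"
    using A Dc by (simp add: P_def transpose_mult[of D d r _ d])
  have FFT: "F * F\<^sup>T = A * A\<^sup>T + R"
  proof -
    have "F * F\<^sup>T = (A * A\<^sup>T + D * A\<^sup>T) + (A * D\<^sup>T + D * D\<^sup>T)"
      using A Dc unfolding FD
      by (simp add: transpose_add[of A d r D] add_mult_distrib_mat[of A d r D _ d]
          mult_add_distrib_mat[of _ d r _ d])
    also have "\<dots> = A * A\<^sup>T + R"
      using A Dc unfolding R_def PT unfolding P_def W_def by (intro eq_matI) (auto simp del: index_mult_mat(1))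
    finally show ?thesis .
  qed
  \<comment> \<open>\<open>R\<close> is \<open>F F\<^sup>T - A A\<^sup>T\<close>, so the feasible
    point \<open>Ss\<close> lies at distance \<open>frob_norm (E - R)\<close> from \<open>X\<close>.
    This bounds both the projection error \<open>S - Ss\<close> and the residual
    \<open>G\<close>.\<close>
  have X: "X - Ss = E - R"
    using A Ss E car unfolding X_def Y FFT by (intro eq_matI) (auto simp del: index_mult_mat(1))
  note proj = entrywise_closed_row_l1_set[OF Ss] mat_convex_row_l1_set[OF Ss] car(3)
  have Ss_mem: "Ss \<in> row_l1_set Ss" using Ss by (simp add: mem_row_l1_set_iff[OF Ss])
  have S_mem: "S \<in> row_l1_set Ss" unfolding S_def using frob_proj_mem[OF proj Ss_mem] .
  then have Sc: "S \<in> carrier_mat d d" by (simp add: mem_row_l1_set_iff[OF Ss])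
  have \<delta>: "0 \<le> \<delta>" "\<delta> \<le> s / 5" "\<delta> = frob_norm D" using small by (auto simp: \<delta>_def D_def)
  define u e where "u = s * \<delta>" and "e = frob_norm E"
  have ue: "0 \<le> u" "0 \<le> e" using \<delta> s by (auto simp: u_def e_def)
  have \<delta>2: "\<delta> * \<delta> \<le> u / 5"
    using mult_right_mono[OF \<delta>(2,1)] by (simp add: u_def)
  have nP: "frob_norm P = u"
  proof -
    have "(frob_norm P)\<^sup>2 = u\<^sup>2"
      using frob_norm_mult_transpose_semi_orth[OF A gram Dc]
      by (simp add: P_def u_def \<delta>(3) power_mult_distrib)
    then show ?thesis using ue by (simp add: power2_eq_iff_nonneg)
  qed
  have nW: "frob_norm W \<le> \<delta> * \<delta>"
    using frob_norm_mult_le[of D d r "D\<^sup>T" d] Dc by (simp add: W_def \<delta>(3))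
  have "frob_norm (P + P\<^sup>T) \<le> 2 * u"
    using frob_norm_triangle[of P d d "P\<^sup>T"] car nP by simp
  then have nR: "frob_norm R \<le> 11/5 * u"
    using frob_norm_triangle[of "P + P\<^sup>T" d d W] car nW \<delta>2 by (simp add: R_def)
  have nER: "frob_norm (E - R) \<le> 11/5 * u + e"
    using frob_norm_triangle_minus[of E d d R] E car nR by (simp add: e_def)
  have nS: "frob_norm (S - Ss) \<le> 11/5 * u + e"
    using frob_norm_proj_diff_le[OF proj Ss_mem] nER X by (simp add: S_def)
  have Gc: "G \<in> carrier_mat d d" using Sc car by (simp add: G_def X_def[symmetric] S_def[symmetric])
  have GS: "G = S - X" by (simp add: G_def X_def S_def)
  have nG: "frob_norm G \<le> 11/5 * u + e"
    using frob_proj_le[OF proj Ss_mem] nER X Sc car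
    by (simp add: GS frob_norm_minus_commute[of S d d X]) (simp add: S_def)
  have G: "G = (S - Ss) + R - E"
  proof -
    have "X = Ss + (E - R)"
      unfolding X[symmetric] using car Ss by (intro eq_matI) auto
    then show ?thesis unfolding GS using Sc Ss E car by (intro eq_matI) auto
  qed
  have DFT: "D * F\<^sup>T = P + W"
    unfolding FD P_def W_def using A Dc
    by (simp add: transpose_add[of A d r D] mult_add_distrib_mat[of _ d r _ d])
  have "mat_inner (G * F) D = mat_inner G (P + W)"
    using mat_inner_mult_right_adjoint[of G d d F r D] Gc F Dc by (simp add: DFT)
  also have "\<dots> = mat_inner (S - Ss) P + mat_inner (S - Ss) W + mat_inner R (P + W) - mat_inner E (P + W)"
    unfolding G using Sc Ss E car
    by (simp add: mat_inner_add_left[of _ d d] mat_inner_minus_left[of _ d d] mat_inner_add_right[of _ d d])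
  finally have main: "mat_inner (G * F) D
    = mat_inner (S - Ss) P + mat_inner (S - Ss) W + mat_inner R (P + W) - mat_inner E (P + W)" .
  \<comment> \<open>Rows of \<open>S - Ss\<close> satisfy the cone bound with factor
    \<open>2 * sqrt k\<close>; together with the row bound \<open>a\<close> this leaves
    \<open>2 * s / 100 = s / 50\<close>.\<close>
  have t1: "\<bar>mat_inner (S - Ss) P\<bar> \<le> u / 50 * (11/5 * u + e)"
  proof -
    have "\<bar>mat_inner (S - Ss) P\<bar> \<le> 2 * sqrt k * a * frob_norm (S - Ss) * frob_norm D"
      unfolding P_def
    proof (rule mat_inner_row_l1_bound[OF _ Dc A])
      fix i assume i: "i < d"
      have "{j \<in> {..<d}. Ss $$ (i, j) \<noteq> 0} = {j. j < d \<and> Ss $$ (i, j) \<noteq> 0}" by auto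
      then have "(\<Sum>j<d. \<bar>S $$ (i, j) - Ss $$ (i, j)\<bar>)
          \<le> 2 * sqrt k * L2_set (\<lambda>j. S $$ (i, j) - Ss $$ (i, j)) {..<d}"
        using S_mem i sparse[OF i] by (intro l1_diff_le_l2_diff) (auto simp: mem_row_l1_set_iff[OF Ss])
      also have "L2_set (\<lambda>j. S $$ (i, j) - Ss $$ (i, j)) {..<d} = l2_norm (row (S - Ss) i)"
        using l2_norm_row[of "S - Ss" d d i] i Sc Ss by (auto intro!: L2_set_cong)
      finally show "(\<Sum>j<d. \<bar>(S - Ss) $$ (i, j)\<bar>) \<le> 2 * sqrt k * l2_norm (row (S - Ss) i)"
        using i Sc Ss by simp
    qed (use a Sc Ss in auto)
    also have "\<dots> = 2 * (a * sqrt k) * \<delta> * frob_norm (S - Ss)"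
      by (simp add: \<delta>(3))
    also have "\<dots> \<le> 2 * (s / 100) * \<delta> * (11/5 * u + e)"
      using a nS \<delta> s by (intro mult_mono) auto
    finally show ?thesis by (simp add: u_def)
  qed
  have t2: "\<bar>mat_inner (S - Ss) W\<bar> \<le> (11/5 * u + e) * (u / 5)"
  proof -
    have "\<bar>mat_inner (S - Ss) W\<bar> \<le> frob_norm (S - Ss) * frob_norm W"
      using Sc Ss car by (intro mat_inner_cauchy_schwarz[of _ d d]) auto
    also have "\<dots> \<le> (11/5 * u + e) * (u / 5)"
      using nS nW \<delta>2 ue by (intro mult_mono) auto
    finally show ?thesis .
  qed
  have t3: "91/100 * u\<^sup>2 \<le> mat_inner R (P + W)"
  proof -
    \<comment> \<open>Symmetry passes from \<open>A\<^sup>T * F\<close> to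
      \<open>A\<^sup>T * D\<close>, as the two differ by a multiple of the identity.\<close>
    have "A\<^sup>T * D = A\<^sup>T * F - s\<^sup>2 \<cdot>\<^sub>m 1\<^sub>m r"
      using A F unfolding D_def by (simp add: mult_minus_distrib_mat[of _ r d] gram)
    moreover have "(s\<^sup>2 \<cdot>\<^sub>m 1\<^sub>m r)\<^sup>T = s\<^sup>2 \<cdot>\<^sub>m 1\<^sub>m r"
      by (intro eq_matI) auto
    ultimately have "(A\<^sup>T * D)\<^sup>T = A\<^sup>T * D"
      using A F sym by (simp add: transpose_minus[of _ r r])
    then show ?thesis
      using factor_curvature[OF A Dc gram] \<delta> by (simp add: u_def R_def P_def W_def PT[unfolded P_def])
  qed
  have t4: "\<bar>mat_inner E (P + W)\<bar> \<le> e * (6/5 * u)"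
  proof -
    have "frob_norm (P + W) \<le> 6/5 * u"
      using frob_norm_triangle[of P d d W] car nP nW \<delta>2 by simp
    then have "e * frob_norm (P + W) \<le> e * (6/5 * u)"
      using ue by (intro mult_left_mono) auto
    then show ?thesis
      using mat_inner_cauchy_schwarz[of E d d "P + W"] E car by (simp add: e_def)
  qed
  \<comment> \<open>Balance of the four terms: \<open>91/100 - 11/250 - 11/25\<close> exceeds 42/100
    for \<open>u\<^sup>2\<close>, and \<open>1/50 + 1/5 + 6/5\<close> stays below 3/2 for
    \<open>u * e\<close>.\<close>
  have "0 \<le> u * e" using ue by simp
  then show "42/100 * (s * \<delta>)\<^sup>2 - 3/2 * (s * \<delta>) * frob_norm E \<le> mat_inner (G * F) (F - A)"
    using main t1 t2 t3 t4 zero_le_power2[of u] unfolding D_def[symmetric] u_def[symmetric] e_def[symmetric]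
    by (simp add: algebra_simps power2_eq_square)
  have "G * F = G * A + G * D"
    using Gc A Dc unfolding FD by (rule mult_add_distrib_mat)
  then have "frob_norm (G * F) \<le> frob_norm (G * A) + frob_norm (G * D)"
    using frob_norm_triangle[of "G * A" d r "G * D"] Gc A Dc by simp
  also have "\<dots> \<le> s * frob_norm G + frob_norm G * \<delta>"
    using frob_norm_mult_semi_orth_le[OF A gram _ Gc] frob_norm_mult_le[OF Gc Dc] s \<delta>
    by (intro add_mono) auto
  also have "\<dots> = (s + \<delta>) * frob_norm G" by (simp add: algebra_simps)
  also have "\<dots> \<le> (6/5 * s) * (11/5 * u + e)"
    using \<delta> s nG by (intro mult_mono) auto
  finally show "frob_norm (G * F) \<le> 6/5 * s * (11/5 * (s * \<delta>) + frob_norm E)"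
    by (simp add: u_def e_def)
qed

text \<open>Expanding the square, the inner product with \<open>G * F\<close> gives a decrease of
  first order in the step size, while the norm of \<open>G * F\<close> enters only with the square
  of the step size. Measuring noise by \<open>\<epsilon> = frob_norm E / s\<close> removes the scale
  \<open>s\<close>.\<close>

lemma gradient_step_contracts:
  assumes A: "A \<in> carrier_mat d r" and F: "F \<in> carrier_mat d r" and gram: "A\<^sup>T * A = s\<^sup>2 \<cdot>\<^sub>m 1\<^sub>m r"
    and s: "0 < s" and sym: "(A\<^sup>T * F)\<^sup>T = A\<^sup>T * F" and small: "frob_norm (F - A) \<le> s / 5"
    and Ss: "Ss \<in> carrier_mat d d"
    and sparse: "\<And>i. i < d \<Longrightarrow> card {j. j < d \<and> Ss $$ (i, j) \<noteq> 0} \<le> k"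
    and E: "E \<in> carrier_mat d d" and Y: "Y = A * A\<^sup>T + Ss + E"
    and a: "\<And>j. j < d \<Longrightarrow> l2_norm (row A j) \<le> a" "0 \<le> a" "a * sqrt k \<le> s / 100"
  shows "(frob_norm (F - (1/100 / s\<^sup>2) \<cdot>\<^sub>m factored_grad Y Ss F - A))\<^sup>2
    \<le> 199/200 * (frob_norm (F - A))\<^sup>2 + 1/5 * (frob_norm E / s)\<^sup>2"
proof -
  define G where "G = frob_proj (row_l1_set Ss) (Y - F * F\<^sup>T) - (Y - F * F\<^sup>T)"
  define \<delta> \<epsilon> where "\<delta> = frob_norm (F - A)" and "\<epsilon> = frob_norm E / s"
  have e: "frob_norm E = s * \<epsilon>" using s by (simp add: \<epsilon>_def)
  have nn: "0 \<le> \<delta>" "0 \<le> \<epsilon>" using s by (auto simp: \<delta>_def \<epsilon>_def)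
  note bounds = factored_grad_bounds[OF A F gram s sym small Ss sparse E Y a,
      folded G_def \<delta>_def, unfolded e]
  have inner: "s\<^sup>2 * (42/100 * \<delta>\<^sup>2 - 3/2 * \<delta> * \<epsilon>) \<le> mat_inner (G * F) (F - A)"
    using bounds(1) by (simp add: algebra_simps power2_eq_square)
  define q where "q = 6/5 * (11/5 * \<delta> + \<epsilon>)"
  have "frob_norm (G * F) \<le> s\<^sup>2 * q"
    using bounds(2) by (simp add: q_def algebra_simps power2_eq_square)
  then have norm: "(frob_norm (G * F))\<^sup>2 \<le> (s\<^sup>2 * q)\<^sup>2"
    by (rule power_mono) simp
  have Gc: "G \<in> carrier_mat d d"
  proof -
    have "Y - F * F\<^sup>T \<in> carrier_mat d d" using F by simp
    moreover have "frob_proj (row_l1_set Ss) (Y - F * F\<^sup>T) \<in> row_l1_set Ss"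
      using entrywise_closed_row_l1_set[OF Ss] mat_convex_row_l1_set[OF Ss] calculation
      by (rule frob_proj_mem[where Q = Ss]) (use Ss in \<open>simp add: mem_row_l1_set_iff[OF Ss]\<close>)
    ultimately show ?thesis by (simp add: G_def)
  qed
  \<comment> \<open>The factor 2 in the gradient doubles the step from 1/100 to 1/50.\<close>
  have "F - (1/100 / s\<^sup>2) \<cdot>\<^sub>m factored_grad Y Ss F - A = (F - A) - (1/50 / s\<^sup>2) \<cdot>\<^sub>m (G * F)"
    unfolding factored_grad_def G_def[symmetric] using A F Gc
    by (intro eq_matI) (auto simp del: index_mult_mat(1))
  then have "(frob_norm (F - (1/100 / s\<^sup>2) \<cdot>\<^sub>m factored_grad Y Ss F - A))\<^sup>2
      = \<delta>\<^sup>2 - 1/25 * (mat_inner (G * F) (F - A) / s\<^sup>2) + 1/2500 * ((frob_norm (G * F))\<^sup>2 / (s\<^sup>2)\<^sup>2)"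
    using frob_norm_minus_sq[of "F - A" d r "(1/50 / s\<^sup>2) \<cdot>\<^sub>m (G * F)"] A F Gc
      mat_inner_commute[of "F - A" d r "G * F"]
    by (simp add: mat_inner_smult_right[of _ d r] frob_norm_smult \<delta>_def power_mult_distrib power_divide)
  also have "\<dots> \<le> \<delta>\<^sup>2 - 1/25 * (42/100 * \<delta>\<^sup>2 - 3/2 * \<delta> * \<epsilon>) + 1/2500 * q\<^sup>2"
  proof -
    have "42/100 * \<delta>\<^sup>2 - 3/2 * \<delta> * \<epsilon> \<le> mat_inner (G * F) (F - A) / s\<^sup>2"
      using inner s by (simp add: pos_le_divide_eq mult.commute)
    moreover have "(frob_norm (G * F))\<^sup>2 / (s\<^sup>2)\<^sup>2 \<le> q\<^sup>2"
      using norm s by (simp add: pos_divide_le_eq power_mult_distrib mult.commute)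
    ultimately show ?thesis
      by (intro add_mono diff_mono mult_left_mono order_refl) auto
  qed
  also have "\<dots> \<le> 199/200 * \<delta>\<^sup>2 + 1/5 * \<epsilon>\<^sup>2"
  proof -
    have "q\<^sup>2 = 36/25 * (121/25 * \<delta>\<^sup>2 + 22/5 * (\<delta> * \<epsilon>) + \<epsilon>\<^sup>2)"
      by (simp add: q_def power2_eq_square algebra_simps)
    \<comment> \<open>A weighted split of the mixed term: a small weight on
      \<open>\<delta>\<^sup>2\<close> preserves the contraction, and the larger one goes to the
      noise.\<close>
    moreover have "10 * (\<delta> * \<epsilon>) \<le> \<delta>\<^sup>2 + 25 * \<epsilon>\<^sup>2"
      using zero_le_power2[of "\<delta> - 5 * \<epsilon>"] by (simp add: power2_eq_square algebra_simps)
    \<comment> \<open>With the squares and the product as independent variables the remaining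
      inequality is linear.\<close>
    moreover have "x - 1/25 * (42/100 * x - 3/2 * z) + 1/2500 * w \<le> 199/200 * x + 1/5 * y"
      if "w = 36/25 * (121/25 * x + 22/5 * z + y)" "10 * z \<le> x + 25 * y" "0 \<le> x" "0 \<le> y"
      for w x y z :: real
      using that by (simp add: field_simps)
    ultimately show ?thesis
      by (simp only: mult.assoc zero_le_power2)
  qed
  finally show ?thesis by (simp add: \<delta>_def \<epsilon>_def)
qed

section \<open>Feasibility of the factors and induction over the iterates\<close>

text \<open>Rows of \<open>A\<close> are as long as those of \<open>Fs\<close>. The radius of the
  set is set by the norm of \<open>F0\<close>, which cannot be much smaller than
  \<open>s * sqrt r\<close>, the norm of the nearby factor \<open>B\<close>.\<close>

lemma orth_factor_mem_incoherent_set: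
  assumes Fs: "Fs \<in> orth_factors r M" and A: "A \<in> orth_factors r M" and B: "B \<in> orth_factors r M"
    and M: "M \<in> carrier_mat d d" and r: "0 < r" and d: "0 < d" and s: "0 < s"
    and gramF: "Fs\<^sup>T * Fs = s\<^sup>2 \<cdot>\<^sub>m 1\<^sub>m r" and gramB: "B\<^sup>T * B = s\<^sup>2 \<cdot>\<^sub>m 1\<^sub>m r"
    and F0: "F0 \<in> carrier_mat d r" and close: "frob_norm (F0 - B) \<le> s / 5"
  shows "A \<in> incoherent_set (incoherence Fs) F0"
proof -
  have car: "Fs \<in> carrier_mat d r" "A \<in> carrier_mat d r" "B \<in> carrier_mat d r"
    using Fs A B M by (auto simp: orth_factors_def)
  define a where "a = two_inf_norm Fs"
  have nonneg: "0 \<le> l2_norm v" for v by (simp add: l2_norm_def sum_nonneg)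
  have row: "L2_set (\<lambda>j. A $$ (i, j)) {..<r} \<le> a" if i: "i < d" for i
  proof -
    have "L2_set (\<lambda>j. A $$ (i, j)) {..<r} = L2_set (\<lambda>j. Fs $$ (i, j)) {..<r}"
      using orth_factors_row_norm[OF A] orth_factors_row_norm[OF Fs] M car i by (simp add: l2_norm_row)
    also have "\<dots> \<le> a"
      using two_inf_norm_le_iff[OF car(1) d, of a] i by (simp add: a_def)
    finally show ?thesis .
  qed
  have a: "0 \<le> a" using row[OF d] order.trans[OF L2_set_nonneg] by blast
  have "(frob_norm (1\<^sub>m r))\<^sup>2 = real r"
    by (simp flip: mat_inner_self add: mat_inner_carrier[of _ r r] if_distrib[of "\<lambda>x. x * _"] cong: if_cong)
  then have "(frob_norm B)\<^sup>2 = s\<^sup>2 * r"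
    using frob_norm_mult_transpose_semi_orth[OF car(3) gramB, of "1\<^sub>m r" r] car by simp
  then have "(frob_norm B)\<^sup>2 = (s * sqrt r)\<^sup>2"
    by (simp add: power_mult_distrib)
  then have nB: "frob_norm B = s * sqrt r"
    using s by (simp add: power2_eq_iff_nonneg)
  have "frob_norm B \<le> frob_norm F0 + s / 5"
  proof -
    have "B = F0 - (F0 - B)" using car F0 by (intro eq_matI) auto
    then show ?thesis
      using frob_norm_triangle_minus[of F0 d r "F0 - B"] close F0 car by simp
  qed
  \<comment> \<open>Converts the slack \<open>s / 5\<close> into at most one fifth of the norm of
    \<open>B\<close>.\<close>
  moreover have "s * 1 \<le> s * sqrt r"
    using r s by (intro mult_left_mono) auto
  ultimately have "4/5 * (s * sqrt r) \<le> frob_norm F0" using nB by simp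
  then have "(4/5 * (s * sqrt r))\<^sup>2 \<le> (frob_norm F0)\<^sup>2"
    using s by (intro power_mono) auto
  then have F0_sq: "16/25 * (s\<^sup>2 * r) \<le> (frob_norm F0)\<^sup>2"
    by (simp add: power_mult_distrib power_divide)
  have \<mu>: "2 * incoherence Fs / real d = 2 * a\<^sup>2 / (s\<^sup>2 * r)"
    using spectral_norm_semi_orth[OF car(1) gramF less_imp_le[OF s] r] car d
    by (simp add: incoherence_def a_def mult.commute)
  \<comment> \<open>The factor 2 in the radius compensates for the loss 16/25, since
    \<open>2 * 16/25\<close> exceeds 1.\<close>
  have "a\<^sup>2 \<le> 2 * a\<^sup>2 / (s\<^sup>2 * r) * (16/25 * (s\<^sup>2 * r))"
    using r s by simp
  also have "\<dots> \<le> 2 * a\<^sup>2 / (s\<^sup>2 * r) * (frob_norm F0)\<^sup>2"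
    using F0_sq r s by (intro mult_left_mono) auto
  finally have "a \<le> sqrt (2 * a\<^sup>2 / (s\<^sup>2 * r) * (frob_norm F0)\<^sup>2)"
    by (rule real_le_rsqrt)
  also have "\<dots> = sqrt (2 * incoherence Fs / real d) * frob_norm F0"
    by (subst real_sqrt_mult) (simp add: \<mu>)
  finally show ?thesis
    using row car by (auto simp: mem_incoherent_set_iff[OF F0 d] intro: order.trans)
qed

text \<open>The induction carries the dimensions and the radius \<open>s / 5\<close> along with the
  error bound, because the contraction of one step holds only within that radius.\<close>

lemma pgd_factor_dist_bound:
  assumes r: "0 < r" and Fs: "Fs \<in> carrier_mat d r" and Ms: "Ms = Fs * Fs\<^sup>T"
    and orth: "\<forall>i<r. \<forall>j<r. i \<noteq> j \<longrightarrow> col Fs i \<bullet> col Fs j = 0"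
    and rank: "vec_space.rank d Ms = r" and ev: "equal_nonzero_eigenvalues Ms"
    and \<mu>: "\<mu> = incoherence Fs"
    and Ss: "Ss \<in> carrier_mat d d" and sparse: "row_col_sparse k Ss"
    and E: "E \<in> carrier_mat d d" and Y: "Y = Ms + Ss + E"
    and k: "\<mu> * real r * real k / real d \<le> 1/10000"
    and noise: "frob_norm E \<le> 1/100 * (spectral_norm Fs)\<^sup>2"
    and F0: "F0 \<in> carrier_mat d r" and close: "factor_dist F0 Fs \<le> 1/5 * spectral_norm Fs"
  defines "F \<equiv> pgd Y Ss \<mu> (1/100 / (spectral_norm Fs)\<^sup>2) F0"
  shows "(factor_dist (F t) Fs)\<^sup>2 \<le> (1 - 1/200) ^ t * (factor_dist F0 Fs)\<^sup>2
    + 40 * (frob_norm E)\<^sup>2 / (spectral_norm Fs)\<^sup>2"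
proof -
  have M: "Ms \<in> carrier_mat d d" using Fs Ms by auto
  have d: "0 < d" using vec_space.rank_le_nc[OF M] rank r by simp
  have Fs_mem: "Fs \<in> orth_factors r Ms" using Fs Ms orth by (auto simp: orth_factors_def)
  obtain s where s: "0 < s" and gram: "\<And>A. A \<in> orth_factors r Ms \<Longrightarrow> A\<^sup>T * A = s\<^sup>2 \<cdot>\<^sub>m 1\<^sub>m r"
    using orth_factors_gram[of r Ms] r Fs_mem rank ev M by auto
  have sn: "spectral_norm Fs = s"
    using spectral_norm_semi_orth[OF Fs gram[OF Fs_mem]] s r by simp
  define \<epsilon> where "\<epsilon> = frob_norm E / s"
  have \<epsilon>: "0 \<le> \<epsilon>" "\<epsilon> \<le> s / 100"
    using noise s by (auto simp: \<epsilon>_def sn pos_divide_le_eq power2_eq_square)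
  define a where "a = two_inf_norm Fs"
  have a_row: "l2_norm (row A j) \<le> a" if "A \<in> orth_factors r Ms" "j < d" for A j
  proof -
    have "l2_norm (row A j) = l2_norm (row Fs j)"
      using orth_factors_row_norm[OF that(1)] orth_factors_row_norm[OF Fs_mem] M that(2) by simp
    then show ?thesis
      using two_inf_norm_le_iff[OF Fs d, of a] that(2) Fs by (simp add: a_def l2_norm_row)
  qed
  have a: "0 \<le> a" "a * sqrt k \<le> s / 100"
  proof -
    show "0 \<le> a"
      using a_row[OF Fs_mem d] Fs d by (auto simp: l2_norm_row intro: order.trans[OF L2_set_nonneg])
    \<comment> \<open>The dimensions cancel in \<open>\<mu> * r * k / d\<close>; the bound 1/10000
      is the square of the 1/100 needed for \<open>a * sqrt k\<close>.\<close>
    have "a\<^sup>2 * k / s\<^sup>2 \<le> 1/10000"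
      using k Fs d r by (simp add: \<mu> incoherence_def a_def sn)
    then have "a\<^sup>2 * k \<le> (s / 100)\<^sup>2"
      using s by (simp add: pos_divide_le_eq power_divide)
    then have "sqrt (a\<^sup>2 * k) \<le> sqrt ((s / 100)\<^sup>2)" by (rule real_sqrt_le_mono)
    then show "a * sqrt k \<le> s / 100" using \<open>0 \<le> a\<close> s by (simp add: real_sqrt_mult)
  qed
  have row_sparse: "card {j. j < d \<and> Ss $$ (i, j) \<noteq> 0} \<le> k" if "i < d" for i
    using sparse that Ss by (auto simp: row_col_sparse_def)
  have Y_car: "Y \<in> carrier_mat d d" using Y E Ss M by simp
  obtain B where B: "B \<in> orth_factors r Ms" "factor_dist F0 Fs = frob_norm (F0 - B)"
    using factor_dist_attained[OF Fs_mem Ms, of F0] F0 Fs by auto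
  have mem: "A \<in> incoherent_set \<mu> F0" if "A \<in> orth_factors r Ms" for A
    unfolding \<mu> using orth_factor_mem_incoherent_set[OF Fs_mem that B(1) M r d s gram[OF Fs_mem] gram[OF B(1)] F0]
      close B(2) sn by simp
  note inc = entrywise_closed_incoherent_set[OF F0 d] mat_convex_incoherent_set[OF F0 d]
  have step: "(factor_dist (F (Suc t)) Fs)\<^sup>2 \<le> 199/200 * (factor_dist (F t) Fs)\<^sup>2 + 1/5 * \<epsilon>\<^sup>2
      \<and> F (Suc t) \<in> carrier_mat d r"
    if Ft: "F t \<in> carrier_mat d r" and small: "factor_dist (F t) Fs \<le> s / 5" for t
  proof -
    obtain A where A: "A \<in> orth_factors r Ms" "factor_dist (F t) Fs = frob_norm (F t - A)"
      "\<And>B. B \<in> orth_factors r Ms \<Longrightarrow> frob_norm (F t - A) \<le> frob_norm (F t - B)"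
      using factor_dist_attained[OF Fs_mem Ms, of "F t"] Ft Fs by auto
    have Ac: "A \<in> carrier_mat d r" and AM: "A * A\<^sup>T = Ms" using A(1) M by (auto simp: orth_factors_def)
    have sym: "(A\<^sup>T * F t)\<^sup>T = A\<^sup>T * F t"
      using closest_orth_factor_symmetric[OF A(1) gram[OF A(1)] _ A(3)] Ft M by simp
    define X where "X = F t - (1/100 / s\<^sup>2) \<cdot>\<^sub>m factored_grad Y Ss (F t)"
    have contr: "(frob_norm (X - A))\<^sup>2 \<le> 199/200 * (factor_dist (F t) Fs)\<^sup>2 + 1/5 * \<epsilon>\<^sup>2"
      unfolding X_def \<epsilon>_def A(2)
      using gradient_step_contracts[OF Ac Ft gram[OF A(1)] s sym _ Ss row_sparse E _ a_row[OF A(1)] a]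
        small A(2) Y AM by simp
    have "frob_proj (row_l1_set Ss) (Y - F t * (F t)\<^sup>T) \<in> row_l1_set Ss"
      using Ft Ss
      by (intro frob_proj_mem[OF entrywise_closed_row_l1_set[OF Ss] mat_convex_row_l1_set[OF Ss], where Q = Ss])
         (auto simp: mem_row_l1_set_iff[OF Ss])
    then have Xc: "X \<in> carrier_mat d r"
      using Ft by (auto simp: X_def factored_grad_def mem_row_l1_set_iff[OF Ss])
    have FS: "F (Suc t) = frob_proj (incoherent_set \<mu> F0) X"
      by (simp add: F_def X_def sn)
    \<comment> \<open>The factor closest to \<open>F t\<close> may not be closest to
      \<open>F (Suc t)\<close>, but it bounds the new distance from above.\<close>
    have "factor_dist (F (Suc t)) Fs \<le> frob_norm (F (Suc t) - A)"
      using factor_dist_le[of A Fs] A(1) Ms Fs by simp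
    also have "\<dots> \<le> frob_norm (X - A)"
      unfolding FS by (rule frob_norm_proj_diff_le[OF inc Xc mem[OF A(1)]])
    finally have le: "factor_dist (F (Suc t)) Fs \<le> frob_norm (X - A)" .
    have FSc: "F (Suc t) \<in> carrier_mat d r"
      unfolding FS using frob_proj_mem[OF inc Xc mem[OF A(1)]] by (simp add: mem_incoherent_set_iff[OF F0 d])
    \<comment> \<open>Attainment shows that the new distance is nonnegative, as squaring the
      inequality requires.\<close>
    obtain A' where "factor_dist (F (Suc t)) Fs = frob_norm (F (Suc t) - A')"
      using factor_dist_attained[OF Fs_mem Ms, of "F (Suc t)"] FSc Fs by auto
    then have "(factor_dist (F (Suc t)) Fs)\<^sup>2 \<le> (frob_norm (X - A))\<^sup>2"
      using le by (intro power_mono) auto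
    then show ?thesis using contr FSc by simp
  qed
  have "F t \<in> carrier_mat d r \<and> factor_dist (F t) Fs \<le> s / 5 \<and>
    (factor_dist (F t) Fs)\<^sup>2 \<le> (199/200) ^ t * (factor_dist F0 Fs)\<^sup>2 + 40 * \<epsilon>\<^sup>2"
  proof (induction t)
    case 0
    then show ?case using F0 close by (simp add: F_def sn)
  next
    case (Suc t)
    note st = step[of t] and IH = Suc.IH
    have bound: "(factor_dist (F (Suc t)) Fs)\<^sup>2 \<le> 199/200 * (factor_dist (F t) Fs)\<^sup>2 + 1/5 * \<epsilon>\<^sup>2"
      using st IH by blast
    have nn: "0 \<le> factor_dist (F t) Fs"
      using factor_dist_attained[OF Fs_mem Ms, of "F t"] IH Fs by (metis carrier_matD(1) frob_norm_nonneg)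
    have "(factor_dist (F t) Fs)\<^sup>2 \<le> (s / 5)\<^sup>2" using IH nn by (intro power_mono) auto
    moreover have "\<epsilon>\<^sup>2 \<le> (s / 100)\<^sup>2" using \<epsilon> by (intro power_mono) auto
    moreover have "(s / 5)\<^sup>2 = s\<^sup>2 / 25" "(s / 100)\<^sup>2 = s\<^sup>2 / 10000"
      by (simp_all add: power_divide)
    \<comment> \<open>At radius \<open>s / 5\<close> the contraction gains
      \<open>s\<^sup>2 / 5000\<close>, whereas the noise adds at most
      \<open>s\<^sup>2 / 50000\<close>.\<close>
    ultimately have "(factor_dist (F (Suc t)) Fs)\<^sup>2 \<le> (s / 5)\<^sup>2"
      using bound zero_le_power2[of s] by linarith
    then have "factor_dist (F (Suc t)) Fs \<le> s / 5"
      by (rule power2_le_imp_le) (use s in simp)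
    \<comment> \<open>The constant 40 is the fixed point of \<open>c = 199/200 * c + 1/5\<close>, so
      the noise term reproduces itself.\<close>
    moreover have "199/200 * (factor_dist (F t) Fs)\<^sup>2
        \<le> 199/200 * ((199/200) ^ t * (factor_dist F0 Fs)\<^sup>2 + 40 * \<epsilon>\<^sup>2)"
      using IH by (intro mult_left_mono) auto
    ultimately show ?case
      using bound st IH by (simp add: algebra_simps)
  qed
  then show ?thesis by (simp add: \<epsilon>_def sn power_divide)
qed

theorem corollary6:
  shows "\<exists>c1 c2 c3 c4 c5 :: real. 0 < c1 \<and> 0 < c2 \<and> 0 < c3 \<and> 0 < c4 \<and> 0 < c5 \<and>
    (\<forall>(d :: nat) (r :: nat) (k :: nat) (\<mu> :: real)
        (Fs :: real mat) (Ms :: real mat) (Ss :: real mat) (E :: real mat) (Y :: real mat)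
        (F0 :: real mat).
       0 < r \<longrightarrow>
       Fs \<in> carrier_mat d r \<longrightarrow> Ms = Fs * Fs\<^sup>T \<longrightarrow>
       (\<forall>i<r. \<forall>j<r. i \<noteq> j \<longrightarrow> col Fs i \<bullet> col Fs j = 0) \<longrightarrow>
       vec_space.rank d Ms = r \<longrightarrow> equal_nonzero_eigenvalues Ms \<longrightarrow>
       \<mu> = incoherence Fs \<longrightarrow>
       Ss \<in> carrier_mat d d \<longrightarrow> Ss\<^sup>T = Ss \<longrightarrow> row_col_sparse k Ss \<longrightarrow>
       E \<in> carrier_mat d d \<longrightarrow> E\<^sup>T = E \<longrightarrow>
       Y = Ms + Ss + E \<longrightarrow>
       \<mu> * real r * real k / real d \<le> c1 \<longrightarrow>
       frob_norm E \<le> c2 * (spectral_norm Fs)\<^sup>2 \<longrightarrow>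
       F0 \<in> carrier_mat d r \<longrightarrow>
       factor_dist F0 Fs \<le> 1/5 * spectral_norm Fs \<longrightarrow>
       (\<forall>t\<ge>1.
          (factor_dist (pgd Y Ss \<mu> (c3 / (spectral_norm Fs)\<^sup>2) F0 t) Fs)\<^sup>2
            \<le> (1 - c4) ^ t * (factor_dist F0 Fs)\<^sup>2
               + c5 * (frob_norm E)\<^sup>2 / (spectral_norm Fs)\<^sup>2))"
\<comment> \<open>The witnesses in the order \<open>c1\<close> to \<open>c5\<close>; the last is the
  noise gain 1/5 of one step divided by the contraction gap 1/200.\<close>
proof (rule exI[of _ "1/10000"], rule exI[of _ "1/100"], rule exI[of _ "1/100"], rule exI[of _ "1/200"],
    rule exI[of _ 40], intro conjI allI impI)
  fix d r k :: nat and \<mu> :: real and Fs Ms Ss E Y F0 :: "real mat" and t :: nat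
  assume "0 < r" "Fs \<in> carrier_mat d r" "Ms = Fs * Fs\<^sup>T"
    "\<forall>i<r. \<forall>j<r. i \<noteq> j \<longrightarrow> col Fs i \<bullet> col Fs j = 0"
    "vec_space.rank d Ms = r" "equal_nonzero_eigenvalues Ms" "\<mu> = incoherence Fs"
    "Ss \<in> carrier_mat d d" "row_col_sparse k Ss" "E \<in> carrier_mat d d" "Y = Ms + Ss + E"
    "\<mu> * real r * real k / real d \<le> 1/10000" "frob_norm E \<le> 1/100 * (spectral_norm Fs)\<^sup>2"
    "F0 \<in> carrier_mat d r" "factor_dist F0 Fs \<le> 1/5 * spectral_norm Fs"
  then show "(factor_dist (pgd Y Ss \<mu> (1/100 / (spectral_norm Fs)\<^sup>2) F0 t) Fs)\<^sup>2
      \<le> (1 - 1/200) ^ t * (factor_dist F0 Fs)\<^sup>2 + 40 * (frob_norm E)\<^sup>2 / (spectral_norm Fs)\<^sup>2"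
    by (rule pgd_factor_dist_bound)
qed simp_all

end
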